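(* Let $l,m$ be positive integers and let $(P_0,\dots,P_m)$ be a Clifford system on $\mathbb{R}^{2l}$. Put $m_1:=m$, $m_2:=l-m-1$ and define $F:\mathbb{R}^{2l}\to\mathbb{R}$ by $$F(x):=\langle x,x\rangle^2-2\sum_{i=0}^{m}\langle P_ix,x\rangle^2 .$$ Then $F$ satisfies the Cartan–Münzner differential equations (with $g=4$) $$\|\operatorname{grad}F(x)\|^2=16\,\|x\|^{6},\qquad \Delta F(x)=8(m_2-m_1)\,\|x\|^{2}\qquad (x\in\mathbb{R}^{2l}).$$ If moreover $m_2>0$, then the levels of $F$ on the unit sphere $S^{2l-1}$ form an isoparametric family with $g=4$ distinct principal curvatures, with multiplicities $(m_1,m_2)$, i.e. with multiplicities $m_1,m_2,m_3=m_1,m_4=m_2$.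
   Context: A (symmetric) Clifford system on $\mathbb{R}^{2l}$ is an $(m+1)$-tuple $(P_0,\dots,P_m)$ of symmetric endomorphisms of the Euclidean space $\mathbb{R}^{2l}$ such that $P_iP_j+P_jP_i=2\delta_{ij}\,\mathrm{Id}$ for all $i,j\in\{0,\dots,m\}$. An oriented hypersurface of a sphere is isoparametric if its principal curvatures are constant; its parallel hypersurfaces are then also isoparametric, and together they form an isoparametric family. The hypersurfaces of the family meant here are the regular level sets $f^{-1}(c)$, $-1<c<1$, of $f:=F|_{S^{2l-1}}$, with unit normal field $\operatorname{grad}f/\|\operatorname{grad}f\|$. The number of distinct principal curvatures is denoted $g$; multiplicities are listed according to the natural order of the principal curvatures, so with $g=4$ they alternate $m_1,m_2,m_1,m_2$. The gradient and Laplacian of $F$ are the Euclidean ones. *)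

theory Defs
  imports "HOL-Analysis.Analysis"
begin

definition clifford_system :: "nat \<Rightarrow> (nat \<Rightarrow> 'a::euclidean_space \<Rightarrow> 'a) \<Rightarrow> bool" where
  "clifford_system m P \<longleftrightarrow>
     (\<forall>i\<le>m. linear (P i) \<and> (\<forall>x y. P i x \<bullet> y = x \<bullet> P i y)) \<and>
     (\<forall>i\<le>m. \<forall>j\<le>m. \<forall>x. P i (P j x) + P j (P i x) = (if i = j then 2 else 0) *\<^sub>R x)"

definition clifford_polynomial :: "nat \<Rightarrow> (nat \<Rightarrow> 'a::euclidean_space \<Rightarrow> 'a) \<Rightarrow> 'a \<Rightarrow> real" where
  "clifford_polynomial m P x = (x \<bullet> x)\<^sup>2 - 2 * (\<Sum>i=0..m. (P i x \<bullet> x)\<^sup>2)"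

definition grad :: "('a::euclidean_space \<Rightarrow> real) \<Rightarrow> 'a \<Rightarrow> 'a" where
  "grad f x = (THE D. GDERIV f x :> D)"

definition laplacian :: "('a::euclidean_space \<Rightarrow> real) \<Rightarrow> 'a \<Rightarrow> real" where
  "laplacian f x = (\<Sum>b\<in>Basis. (deriv ^^ 2) (\<lambda>t. f (x + t *\<^sub>R b)) 0)"

text \<open>
  Geometry of the unit sphere. In the following \<open>f\<close> stands for its restriction to
  \<open>sphere 0 1\<close>: derivatives are taken within the sphere, so only the values of \<open>f\<close> there matter.
  A derivative within the sphere at \<open>x\<close> is determined only on the tangent space
  \<open>{v. v \<bullet> x = 0}\<close>; hence the gradient is required to be tangent, and the derivative of the unit
  normal is evaluated on tangent vectors only.
\<close>

definition sphere_grad :: "('a::euclidean_space \<Rightarrow> real) \<Rightarrow> 'a \<Rightarrow> 'a" where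
  "sphere_grad f x =
     (THE D. D \<bullet> x = 0 \<and> (f has_derivative (\<lambda>h. D \<bullet> h)) (at x within sphere 0 1))"

definition unit_normal :: "('a::euclidean_space \<Rightarrow> real) \<Rightarrow> 'a \<Rightarrow> 'a" where
  "unit_normal f x = sphere_grad f x /\<^sub>R norm (sphere_grad f x)"

definition level :: "('a::euclidean_space \<Rightarrow> real) \<Rightarrow> real \<Rightarrow> 'a set" where
  "level f c = {x \<in> sphere 0 1. f x = c}"

definition regular_level :: "('a::euclidean_space \<Rightarrow> real) \<Rightarrow> real \<Rightarrow> bool" where
  "regular_level f c \<longleftrightarrow> level f c \<noteq> {} \<and>
     (\<forall>x\<in>level f c. f differentiable (at x within sphere 0 1) \<and> sphere_grad f x \<noteq> 0 \<and>
        unit_normal f differentiable (at x within sphere 0 1))"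

text \<open>The tangent space at \<open>x\<close> of the level of \<open>f\<close> through \<open>x\<close>.\<close>

definition level_tangent :: "('a::euclidean_space \<Rightarrow> real) \<Rightarrow> 'a \<Rightarrow> 'a set" where
  "level_tangent f x = {v. v \<bullet> x = 0 \<and> v \<bullet> sphere_grad f x = 0}"

text \<open>
  Sign convention: the shape operator is \<open>A v = - \<nabla>\<^sub>v \<xi>\<close>, where \<open>\<xi>\<close> is the unit normal
  field and \<open>\<nabla>\<close> the Levi-Civita connection of the sphere, that is, the derivative followed by
  the orthogonal projection onto the tangent space of the sphere.
\<close>

definition shape_operator :: "('a::euclidean_space \<Rightarrow> real) \<Rightarrow> 'a \<Rightarrow> 'a \<Rightarrow> 'a" where
  "shape_operator f x v =
     (let w = frechet_derivative (unit_normal f) (at x within sphere 0 1) v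
      in - (w - (w \<bullet> x) *\<^sub>R x))"

definition principal_curvatures :: "('a::euclidean_space \<Rightarrow> real) \<Rightarrow> 'a \<Rightarrow> real set" where
  "principal_curvatures f x =
     {\<kappa>. \<exists>v\<in>level_tangent f x. v \<noteq> 0 \<and> shape_operator f x v = \<kappa> *\<^sub>R v}"

definition curvature_multiplicity :: "('a::euclidean_space \<Rightarrow> real) \<Rightarrow> 'a \<Rightarrow> real \<Rightarrow> nat" where
  "curvature_multiplicity f x \<kappa> = dim {v \<in> level_tangent f x. shape_operator f x v = \<kappa> *\<^sub>R v}"

definition isoparametric_level :: "('a::euclidean_space \<Rightarrow> real) \<Rightarrow> real \<Rightarrow> bool" where
  "isoparametric_level f c \<longleftrightarrow> regular_level f c \<and>
     (\<forall>x\<in>level f c. \<forall>y\<in>level f c.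
        principal_curvatures f x = principal_curvatures f y \<and>
        (\<forall>\<kappa>. curvature_multiplicity f x \<kappa> = curvature_multiplicity f y \<kappa>))"

text \<open>
  The image of a level under the normal exponential map of the sphere at signed distance \<open>t\<close>.
  On a principal vector of curvature \<open>\<kappa>\<close> the differential of this map is multiplication by
  \<open>cos t - \<kappa> sin t\<close> (up to parallel translation), so the image is again a hypersurface when
  \<open>t\<close> is not a focal distance.
\<close>

definition parallel_level :: "('a::euclidean_space \<Rightarrow> real) \<Rightarrow> real \<Rightarrow> real \<Rightarrow> 'a set" where
  "parallel_level f c t = (\<lambda>x. cos t *\<^sub>R x + sin t *\<^sub>R unit_normal f x) ` level f c"

definition focal_distance :: "('a::euclidean_space \<Rightarrow> real) \<Rightarrow> real \<Rightarrow> real \<Rightarrow> bool" where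
  "focal_distance f c t \<longleftrightarrow>
     (\<exists>x\<in>level f c. \<exists>\<kappa>\<in>principal_curvatures f x. cos t = \<kappa> * sin t)"

text \<open>
  The levels \<open>f = c\<close> with \<open>-1 < c < 1\<close> are isoparametric hypersurfaces, and they are exactly
  the parallel hypersurfaces of any one of them.
\<close>

definition isoparametric_family :: "('a::euclidean_space \<Rightarrow> real) \<Rightarrow> bool" where
  "isoparametric_family f \<longleftrightarrow>
     (\<forall>c\<in>{-1<..<1}. isoparametric_level f c) \<and>
     (\<forall>c\<in>{-1<..<1}. level f ` {-1<..<1} = parallel_level f c ` {t. \<not> focal_distance f c t})"

text \<open>
  Multiplicities are listed along decreasing principal curvatures
  \<open>\<kappa>\<^sub>1 > \<kappa>\<^sub>2 > \<dots>\<close>, the order that belongs to the above sign of the shape operator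
  (\<open>\<kappa>\<^sub>i = cot (\<theta> + (i - 1) \<pi> / g)\<close> in Muenzner's normalisation). Reversing the sign of the
  shape operator together with the order gives the same list.
\<close>

definition has_multiplicities :: "('a::euclidean_space \<Rightarrow> real) \<Rightarrow> real \<Rightarrow> nat list \<Rightarrow> bool" where
  "has_multiplicities f c ms \<longleftrightarrow>
     (\<exists>\<kappa>s. sorted_wrt (>) \<kappa>s \<and>
        (\<forall>x\<in>level f c. principal_curvatures f x = set \<kappa>s \<and>
           map (curvature_multiplicity f x) \<kappa>s = ms))"

end

(* Let x be a unit vector with -1 < F x < 1 and write <P_i x, x> = s q_i with |q| = 1, s > 0 and
   c = sqrt (1 - s^2), so that F x = 1 - 2 s^2. The symmetric involution Q = sum q_i P_i satisfies
   <Qx, x> = s, the unit normal is nu = (s x - Q x) / c, and Q acts on span {x, nu} as a reflection.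
   Hence along the geodesic cos t x + sin t nu the vector q stays fixed and, for s = sin psi, the
   angle psi becomes psi - 2 t; this describes the parallel hypersurfaces.

   On the tangent space {x, Qx}^perp of the level, c times the shape operator is
   v |-> Q v + (2/s) pr_W v - s v, where W = span {P_i x}. Vectors orthogonal to W with Q v = +-v are
   eigenvectors, and so are suitable combinations of w and Q w for w in W orthogonal to Qx. This
   bounds the dimensions of four eigenspaces from below by m, l-m-1, m, l-m-1; these numbers add up
   to the dimension 2l-2 of the tangent space, so the bounds are sharp and there are no other
   eigenvalues. *)

theory Submission
  imports Defs
begin

text \<open>The natural angle is A = 2 \<psi>: the value of F is 1 - 2 sin(\<psi>)^2 = cos A, so a
  normal displacement t turns A into A - 4 t, and this 4 is the number g. The four curvatures are
  cot (A/4 + j pi/4), j = 0, ..., 3, written algebraically in s and c. Derivatives within the sphere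
  are determined on tangent vectors only, and off the sphere the unit normal has no meaning. The
  shape operator is therefore computed from an extension of the normal to the ambient space. The
  bound l - m - 1 arises as follows. Since m > 0, some combination of the P_i anticommutes with Q
  and exchanges its two eigenspaces, which thus have dimension l. On them, orthogonality to x and to
  Qx are the same condition, and Qx lies in W; so being tangent and orthogonal to W amounts to m + 1
  conditions. The bound m is the dimension m + 1 of W less the direction Qx. Nothing so far produces
  a point on a given level; this needs an explicit great circle, whose construction again uses the
  dimension l of the eigenspaces.\<close>

subsection \<open>Derivatives within the sphere\<close>

text \<open>A tangent vector is, up to scaling, the velocity of a great circle through
  \<open>x\<close>. Along this curve the chain rule turns a derivative within the sphere into an
  ordinary one, which is unique.\<close>

lemma sphere_derivative_unique:
  fixes f :: "'a::euclidean_space \<Rightarrow> 'b::real_normed_vector"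
  assumes x: "norm x = 1" and v: "v \<bullet> x = 0"
    and f1: "(f has_derivative f1) (at x within sphere 0 1)"
    and f2: "(f has_derivative f2) (at x within sphere 0 1)"
  shows "f1 v = f2 v"
proof (cases "v = 0")
  case True
  then show ?thesis
    using f1 f2 by (simp add: has_derivative_def linear_0 bounded_linear.linear)
next
  case False
  define u where "u = v /\<^sub>R norm v"
  have u: "norm u = 1" "u \<bullet> x = 0"
    using False v by (auto simp: u_def)
  define g where "g t = cos t *\<^sub>R x + sin t *\<^sub>R u" for t :: real
  have g_sphere: "g t \<in> sphere 0 1" for t
  proof -
    have "(norm (g t))\<^sup>2 = (cos t)\<^sup>2 * (x \<bullet> x) + (sin t)\<^sup>2 * (u \<bullet> u) + 2 * cos t * sin t * (u \<bullet> x)"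
      unfolding power2_norm_eq_inner g_def
      by (simp add: algebra_simps inner_commute power2_eq_square)
    also have "\<dots> = 1"
      using x u by (simp add: norm_eq_1)
    finally show ?thesis
      by (simp add: power2_eq_1_iff) (use norm_ge_zero[of "g t"] in linarith)
  qed
  have g_deriv: "(g has_derivative (\<lambda>t. t *\<^sub>R u)) (at 0)"
    unfolding g_def by (auto intro!: derivative_eq_intros)
  have comp: "((\<lambda>t. f (g t)) has_derivative (\<lambda>t. f' (t *\<^sub>R u))) (at 0)"
    if "(f has_derivative f') (at x within sphere 0 1)" for f'
  proof -
    have "(f has_derivative f') (at (g 0) within range g)"
      using that g_sphere by (auto simp: g_def intro: has_derivative_subset)
    then show ?thesis
      using diff_chain_within[OF g_deriv] by (simp add: o_def)
  qed
  have "f1 u = f2 u"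
    using has_derivative_unique[OF comp[OF f1] comp[OF f2]] by (metis scaleR_one)
  moreover have "v = norm v *\<^sub>R u"
    using False by (simp add: u_def)
  ultimately show ?thesis
    using f1 f2 by (metis has_derivative_linear linear_cmul)
qed

text \<open>The difference of two candidates is itself tangent, so both derivatives agree on it and
  its square norm vanishes. Hence the description in \<open>sphere_grad\<close> picks out a single
  vector.\<close>

lemma sphere_grad_eqI:
  assumes x: "norm x = 1" and D: "D \<bullet> x = 0"
    and f: "(f has_derivative (\<lambda>h. D \<bullet> h)) (at x within sphere 0 1)"
  shows "sphere_grad f x = D"
  unfolding sphere_grad_def
proof (rule the_equality)
  show "D \<bullet> x = 0 \<and> (f has_derivative (\<lambda>h. D \<bullet> h)) (at x within sphere 0 1)"
    using D f by simp
  fix E assume E: "E \<bullet> x = 0 \<and> (f has_derivative (\<lambda>h. E \<bullet> h)) (at x within sphere 0 1)"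
  then have "E \<bullet> (E - D) = D \<bullet> (E - D)"
    using sphere_derivative_unique[OF x, of "E - D" f] D f by (simp add: inner_diff_left)
  then have "(E - D) \<bullet> (E - D) = 0"
    by (simp add: inner_diff_left)
  then show "E = D" by simp
qed

text \<open>On the sphere \<open>f\<close> agrees with \<open>f - k/2 (y \<bullet> y - 1)\<close>; the choice \<open>k = G \<bullet> x\<close> makes the
  gradient of the latter tangent.\<close>

lemma sphere_grad_eq_tangential_part:
  fixes f :: "'a::euclidean_space \<Rightarrow> real"
  assumes x: "norm x = 1" and f: "(f has_derivative (\<lambda>h. G \<bullet> h)) (at x)"
  shows "sphere_grad f x = G - (G \<bullet> x) *\<^sub>R x"
proof (rule sphere_grad_eqI[OF x])
  show "(G - (G \<bullet> x) *\<^sub>R x) \<bullet> x = 0"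
    using x by (simp add: inner_diff_left norm_eq_1)
  have "((\<lambda>y. f y - (G \<bullet> x) / 2 * (y \<bullet> y - 1)) has_derivative (\<lambda>h. (G - (G \<bullet> x) *\<^sub>R x) \<bullet> h))
      (at x within sphere 0 1)"
    by (rule derivative_eq_intros has_derivative_at_withinI[OF f] refl)+
      (auto simp: algebra_simps inner_commute)
  then show "(f has_derivative (\<lambda>h. (G - (G \<bullet> x) *\<^sub>R x) \<bullet> h)) (at x within sphere 0 1)"
    by (rule has_derivative_transform[rotated 2]) (use x in \<open>auto simp: norm_eq_1\<close>)
qed

subsection \<open>Dimension bounds\<close>

text \<open>Each vector of \<open>Y\<close> costs at most one dimension, by the dimension formula
  for the sum and the intersection of \<open>S\<close> with the orthogonal complement of
  \<open>Y\<close>.\<close>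

lemma dim_orthogonal_within_ge:
  fixes S :: "'a::euclidean_space set"
  assumes S: "subspace S" and Y: "finite Y"
  shows "dim S \<le> dim {v \<in> S. \<forall>y\<in>Y. v \<bullet> y = 0} + card Y"
proof -
  let ?N = "{v. \<forall>y\<in>Y. v \<bullet> y = 0}"
  have N: "subspace ?N"
    by (auto simp: subspace_def inner_add_left)
  have "?N = {v \<in> UNIV. \<forall>y\<in>span Y. orthogonal y v}"
    by (auto simp: orthogonal_commute orthogonal_def span_base
      dest: orthogonal_to_span[unfolded orthogonal_def])
  then have "dim ?N + dim Y = DIM('a)"
    using dim_subspace_orthogonal_to_vectors[of "span Y" UNIV] by (simp add: dim_UNIV)
  moreover have "dim Y \<le> card Y"
    by (rule dim_le_card'[OF Y])
  moreover have "dim {x + y |x y. x \<in> S \<and> y \<in> ?N} + dim (S \<inter> ?N) = dim S + dim ?N"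
    by (rule dim_sums_Int[OF S N])
  moreover have "dim {x + y |x y. x \<in> S \<and> y \<in> ?N} \<le> DIM('a)"
    by (rule dim_subset_UNIV)
  moreover have "S \<inter> ?N = {v \<in> S. \<forall>y\<in>Y. v \<bullet> y = 0}"
    by auto
  ultimately show ?thesis by simp
qed

text \<open>Eigenvectors of a symmetric map for different eigenvalues are orthogonal, so the
  dimensions add up.\<close>

lemma dim_UN_eigenspaces:
  fixes T :: "'a::euclidean_space set" and K :: "real set"
  assumes sym: "\<And>v w. v \<in> T \<Longrightarrow> w \<in> T \<Longrightarrow> A v \<bullet> w = v \<bullet> A w" and K: "finite K"
  shows "dim (\<Union>\<kappa>\<in>K. {v \<in> T. A v = \<kappa> *\<^sub>R v}) = (\<Sum>\<kappa>\<in>K. dim {v \<in> T. A v = \<kappa> *\<^sub>R v})"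
  using K
proof (induction K)
  case (insert \<kappa> K)
  have "v \<bullet> w = 0" if "v \<in> T" "w \<in> T" "A v = \<kappa> *\<^sub>R v" "A w = \<mu> *\<^sub>R w" "\<mu> \<in> K" for v w \<mu>
  proof -
    have "\<kappa> * (v \<bullet> w) = \<mu> * (v \<bullet> w)"
      using sym[OF that(1,2)] that(3,4) by simp
    moreover have "\<kappa> \<noteq> \<mu>" using insert that(5) by auto
    ultimately show ?thesis by simp
  qed
  then have "dim ({v \<in> T. A v = \<kappa> *\<^sub>R v} \<union> (\<Union>\<kappa>\<in>K. {v \<in> T. A v = \<kappa> *\<^sub>R v})) =
      dim {v \<in> T. A v = \<kappa> *\<^sub>R v} + dim (\<Union>\<kappa>\<in>K. {v \<in> T. A v = \<kappa> *\<^sub>R v})"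
    by (intro dim_orthogonal_sum) auto
  then show ?case using insert by simp
qed simp

text \<open>A squeeze. Over any finite set of eigenvalues the dimensions sum to at most
  \<open>dim T\<close>, hence to at most the sum of the \<open>d \<kappa>\<close>. For
  \<open>K\<close> itself this forces equality term by term; for \<open>K\<close> with one further
  eigenvalue it leaves no room for the latter.\<close>

lemma eigenspace_dims_eqI:
  fixes T :: "'a::euclidean_space set" and K :: "real set"
  assumes sym: "\<And>v w. v \<in> T \<Longrightarrow> w \<in> T \<Longrightarrow> A v \<bullet> w = v \<bullet> A w" and K: "finite K"
    and lower: "\<And>\<kappa>. \<kappa> \<in> K \<Longrightarrow> d \<kappa> \<le> dim {v \<in> T. A v = \<kappa> *\<^sub>R v}"
    and full: "dim T \<le> (\<Sum>\<kappa>\<in>K. d \<kappa>)"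
  shows "dim {v \<in> T. A v = \<kappa> *\<^sub>R v} = (if \<kappa> \<in> K then d \<kappa> else 0)"
proof -
  let ?E = "\<lambda>\<kappa>. {v \<in> T. A v = \<kappa> *\<^sub>R v}"
  have upper: "(\<Sum>\<kappa>\<in>L. dim (?E \<kappa>)) \<le> (\<Sum>\<kappa>\<in>K. d \<kappa>)" if "finite L" for L
  proof -
    have "(\<Sum>\<kappa>\<in>L. dim (?E \<kappa>)) = dim (\<Union>\<kappa>\<in>L. ?E \<kappa>)"
      using dim_UN_eigenspaces[OF sym that] by simp
    also have "\<dots> \<le> dim T" by (intro dim_subset) auto
    finally show ?thesis using full by simp
  qed
  have low: "(\<Sum>\<kappa>\<in>K. d \<kappa>) \<le> (\<Sum>\<kappa>\<in>K. dim (?E \<kappa>))"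
    using lower by (rule sum_mono)
  show ?thesis
  proof (cases "\<kappa> \<in> K")
    case True
    have "d \<kappa> = dim (?E \<kappa>)"
    proof (rule ccontr)
      assume "d \<kappa> \<noteq> dim (?E \<kappa>)"
      then have "(\<Sum>\<kappa>\<in>K. d \<kappa>) < (\<Sum>\<kappa>\<in>K. dim (?E \<kappa>))"
        using K True lower by (intro sum_strict_mono_ex1) (auto simp: le_less)
      then show False using upper[OF K] by simp
    qed
    then show ?thesis using True by simp
  next
    case False
    then show ?thesis using upper[of "insert \<kappa> K"] low K by (simp del: dim_eq_0)
  qed
qed

subsection \<open>Clifford systems and the Cartan--Muenzner equations\<close>

locale clifford =
  fixes m :: nat and P :: "nat \<Rightarrow> 'a::euclidean_space \<Rightarrow> 'a"
  assumes system: "clifford_system m P"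
begin

abbreviation F :: "'a \<Rightarrow> real" where "F \<equiv> clifford_polynomial m P"

text \<open>Coefficient vectors are functions on \<open>nat\<close> of which only the values up to
  \<open>m\<close> count, because the dimension \<open>m + 1\<close> is a term and not a type. With
  \<open>ip\<close> below as inner product, the unit vectors \<open>r\<close> give the Clifford
  sphere of symmetric involutions.\<close>

definition comb :: "(nat \<Rightarrow> real) \<Rightarrow> 'a \<Rightarrow> 'a" where
  "comb r y = (\<Sum>i\<le>m. r i *\<^sub>R P i y)"

definition ip :: "(nat \<Rightarrow> real) \<Rightarrow> (nat \<Rightarrow> real) \<Rightarrow> real" where
  "ip r q = (\<Sum>i\<le>m. r i * q i)"

lemma linear_P: "i \<le> m \<Longrightarrow> linear (P i)"
  and sym_P: "i \<le> m \<Longrightarrow> P i x \<bullet> y = x \<bullet> P i y"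
  and anti_P: "i \<le> m \<Longrightarrow> j \<le> m \<Longrightarrow> P i (P j x) + P j (P i x) = (if i = j then 2 else 0) *\<^sub>R x"
  using system unfolding clifford_system_def by blast+

lemma linear_comb: "linear (comb r)"
  unfolding comb_def by (intro linear_compose_sum linear_compose_scale_right ballI linear_P) auto

lemmas comb_simps = linear_add[OF linear_comb] linear_diff[OF linear_comb]
  linear_cmul[OF linear_comb] linear_neg[OF linear_comb]

lemma sym_comb: "comb r x \<bullet> y = x \<bullet> comb r y"
  by (simp add: comb_def inner_sum_left inner_sum_right sym_P)

lemma ip_commute: "ip r q = ip q r"
  by (simp add: ip_def mult.commute)

text \<open>The Clifford relations extended bilinearly. Orthogonal coefficient vectors give
  anticommuting maps, and \<open>r = q\<close> gives a multiple of the identity.\<close>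

lemma anti_comb: "comb r (comb q y) + comb q (comb r y) = (2 * ip r q) *\<^sub>R y"
proof -
  have "comb r (comb q y) = (\<Sum>i\<le>m. \<Sum>j\<le>m. (r i * q j) *\<^sub>R P i (P j y))" for r q
    by (simp add: comb_def linear_sum[OF linear_P] linear_cmul[OF linear_P] scaleR_sum_right)
  note expand = this
  have "comb q (comb r y) = (\<Sum>i\<le>m. \<Sum>j\<le>m. (r i * q j) *\<^sub>R P j (P i y))"
    unfolding expand by (subst sum.swap) (simp add: mult.commute)
  then have "comb r (comb q y) + comb q (comb r y) =
      (\<Sum>i\<le>m. \<Sum>j\<le>m. (r i * q j) *\<^sub>R (P i (P j y) + P j (P i y)))"
    by (simp add: expand sum.distrib scaleR_add_right)
  also have "\<dots> = (\<Sum>i\<le>m. \<Sum>j\<le>m. (if i = j then (2 * (r i * q j)) *\<^sub>R y else 0))"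
    by (intro sum.cong refl) (simp add: anti_P)
  also have "\<dots> = (\<Sum>i\<le>m. (2 * (r i * q i)) *\<^sub>R y)"
    by (simp add: sum.delta)
  finally show ?thesis
    by (simp add: ip_def scaleR_sum_left sum_distrib_left)
qed

lemma comb_comb_self: "comb r (comb r y) = ip r r *\<^sub>R y"
proof -
  have "2 *\<^sub>R comb r (comb r y) = (2 * ip r r) *\<^sub>R y"
    using anti_comb[of r r y] by (simp only: scaleR_2)
  then have "(1 / 2) *\<^sub>R 2 *\<^sub>R comb r (comb r y) = (1 / 2) *\<^sub>R (2 * ip r r) *\<^sub>R y"
    by (rule arg_cong)
  then show ?thesis by simp
qed

text \<open>Symmetry moves both maps to one side, where only their symmetrised product counts. For a
  unit vector \<open>y\<close>, sending \<open>r\<close> to \<open>comb r y\<close> is thus an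
  isometric embedding.\<close>

lemma comb_inner_comb: "comb r y \<bullet> comb q y = ip r q * (y \<bullet> y)"
proof -
  have "2 * (comb r y \<bullet> comb q y) = comb r (comb q y) \<bullet> y + comb q (comb r y) \<bullet> y"
    using sym_comb[of r "comb q y" y] sym_comb[of q "comb r y" y]
    by (simp add: inner_commute)
  also have "\<dots> = 2 * (ip r q * (y \<bullet> y))"
    using arg_cong[OF anti_comb[of r q y], of "\<lambda>z. z \<bullet> y"] by (simp add: inner_add_left)
  finally show ?thesis by simp
qed

lemma comb_inner: "comb r y \<bullet> z = (\<Sum>i\<le>m. r i * (P i y \<bullet> z))"
  by (simp add: comb_def inner_sum_left)

lemma comb_delta: "i \<le> m \<Longrightarrow> comb (\<lambda>k. if k = i then 1 else 0) = P i"
  by (auto simp: comb_def if_distrib[of "\<lambda>c. c *\<^sub>R _"] sum.delta cong: if_cong)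

lemma ip_delta: "i \<le> m \<Longrightarrow> ip (\<lambda>k. if k = i then 1 else 0) r = r i"
  by (auto simp: ip_def if_distrib[of "\<lambda>c. c * _"] sum.delta cong: if_cong)

lemma P_inner_comb: "i \<le> m \<Longrightarrow> P i y \<bullet> comb r y = r i * (y \<bullet> y)"
  using comb_inner_comb[of "\<lambda>k. if k = i then 1 else 0" y r] by (simp add: comb_delta ip_delta)

lemma P_inner_P: "i \<le> m \<Longrightarrow> j \<le> m \<Longrightarrow> P i y \<bullet> P j y = (if i = j then y \<bullet> y else 0)"
  using P_inner_comb[of i y "\<lambda>k. if k = j then 1 else 0"] by (simp add: comb_delta)

section \<open>The polynomial \<open>F\<close>, its Euclidean gradient and its Laplacian\<close>

abbreviation cf :: "'a \<Rightarrow> nat \<Rightarrow> real" where "cf x \<equiv> (\<lambda>i. P i x \<bullet> x)"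

lemma F_eq: "F x = (x \<bullet> x)\<^sup>2 - 2 * ip (cf x) (cf x)"
  by (simp add: clifford_polynomial_def ip_def power2_eq_square atLeast0AtMost)

definition gradF :: "'a \<Rightarrow> 'a" where
  "gradF x = (4 * (x \<bullet> x)) *\<^sub>R x - 8 *\<^sub>R comb (cf x) x"

lemma P_has_derivative: "i \<le> m \<Longrightarrow> (P i has_derivative P i) F'"
  by (simp add: linear_P linear_linear linear_imp_has_derivative)

lemma cf_has_derivative:
  "i \<le> m \<Longrightarrow> ((\<lambda>y. P i y \<bullet> y) has_derivative (\<lambda>h. 2 * (P i x \<bullet> h))) (at x within S)"
  by (rule derivative_eq_intros P_has_derivative refl | assumption)+
    (use sym_P[of i x] in \<open>simp add: inner_commute fun_eq_iff\<close>)

lemma F_has_derivative: "(F has_derivative (\<lambda>h. gradF x \<bullet> h)) (at x within S)"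
proof -
  have "((\<lambda>y. \<Sum>i\<le>m. (P i y \<bullet> y)\<^sup>2) has_derivative
      (\<lambda>h. \<Sum>i\<le>m. 4 * ((P i x \<bullet> x) * (P i x \<bullet> h)))) (at x within S)"
    by (rule has_derivative_sum)
      (rule has_derivative_eq_rhs[OF has_derivative_power[OF cf_has_derivative]]; simp add: mult_ac)
  moreover have "((\<lambda>y. (y \<bullet> y)\<^sup>2) has_derivative (\<lambda>h. 4 * (x \<bullet> x) * (x \<bullet> h))) (at x within S)"
    by (rule derivative_eq_intros refl)+ (auto simp: inner_commute)
  ultimately have "((\<lambda>x. (x \<bullet> x)\<^sup>2 - 2 * (\<Sum>i\<le>m. (P i x \<bullet> x)\<^sup>2)) has_derivative
      (\<lambda>h. 4 * (x \<bullet> x) * (x \<bullet> h) - 2 * (\<Sum>i\<le>m. 4 * ((P i x \<bullet> x) * (P i x \<bullet> h)))))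
      (at x within S)"
    by (intro has_derivative_diff has_derivative_mult_right)
  also have "(\<lambda>h. 4 * (x \<bullet> x) * (x \<bullet> h) - 2 * (\<Sum>i\<le>m. 4 * ((P i x \<bullet> x) * (P i x \<bullet> h)))) =
      (\<lambda>h. gradF x \<bullet> h)"
    by (simp add: gradF_def inner_diff_left comb_inner fun_eq_iff flip: sum_distrib_left)
  finally show ?thesis
    by (simp add: clifford_polynomial_def[abs_def] atLeast0AtMost)
qed

text \<open>This is Euler's identity for degree 4; it gives the radial part to be removed from the
  gradient on the sphere.\<close>

lemma gradF_inner_self: "gradF x \<bullet> x = 4 * F x"
  by (simp add: gradF_def inner_diff_left comb_inner F_eq ip_def power2_eq_square)

lemma comb_cf_inner: "comb (cf x) x \<bullet> x = ip (cf x) (cf x)"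
  by (simp add: comb_inner ip_def)

lemma grad_F: "grad F x = gradF x"
  unfolding grad_def
proof (rule the_equality)
  show "GDERIV F x :> gradF x"
    using F_has_derivative[of x UNIV] by (simp add: gderiv_def inner_commute)
  fix D assume "GDERIV F x :> D"
  then have "(\<lambda>h. D \<bullet> h) = (\<lambda>h. gradF x \<bullet> h)"
    using has_derivative_unique F_has_derivative[of x UNIV] by (simp add: gderiv_def inner_commute)
  then show "D = gradF x"
    by (metis vector_eq_rdot inner_commute)
qed

text \<open>By \<open>comb_inner_comb\<close> the square of the second summand of
  \<open>gradF\<close> is 64 (x . x) \<open>ip (cf x) (cf x)\<close>; the mixed term is the negative
  of this, thanks to the factor 2 in \<open>F\<close>.\<close>

lemma norm_grad_F: "(norm (grad F x))\<^sup>2 = 16 * norm x ^ 6"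
proof -
  have "(norm (grad F x))\<^sup>2 = 16 * (x \<bullet> x) ^ 3"
    unfolding grad_F power2_norm_eq_inner gradF_def
    by (simp add: inner_diff_left inner_diff_right comb_inner_comb comb_cf_inner
        inner_commute[of x "comb (cf x) x"] algebra_simps power3_eq_cube)
  also have "\<dots> = 16 * norm x ^ 6"
    by (simp add: power2_norm_eq_inner[symmetric] flip: power_mult)
  finally show ?thesis .
qed

text \<open>Conjugation by some \<open>P j\<close> with \<open>j \<noteq> i\<close> preserves the
  trace, as \<open>P j\<close> is orthogonal, but turns \<open>P i\<close> into its negative.
  Invariance of the trace is proved by expanding in \<open>Basis\<close> and exchanging the two
  sums.\<close>

lemma trace_P:
  assumes m: "0 < m" and i: "i \<le> m"
  shows "(\<Sum>b\<in>Basis. P i b \<bullet> b) = 0"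
proof -
  define j where "j = (if i = 0 then 1 else 0 :: nat)"
  have j: "j \<le> m" "i \<noteq> j" using m by (auto simp: j_def)
  have PP: "P j (P j y) = y" for y
    using comb_comb_self[of "\<lambda>k. if k = j then 1 else 0" y] j by (simp add: comb_delta ip_delta)
  have "P i (P j b) = - P j (P i b)" for b
    using anti_P[OF i j(1), of b] j(2) by (simp add: eq_neg_iff_add_eq_0)
  then have neg: "P i (P j b) \<bullet> P j b = - (P i b \<bullet> b)" for b
    using j sym_P[of j "P i b" "P j b"] by (simp add: PP)
  have "(\<Sum>b\<in>Basis. P i (P j b) \<bullet> P j b) =
      (\<Sum>b\<in>Basis. \<Sum>c\<in>Basis. (P i (P j b) \<bullet> c) * (P j b \<bullet> c))"
    by (intro sum.cong refl euclidean_inner)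
  also have "\<dots> = (\<Sum>b\<in>Basis. \<Sum>c\<in>Basis. (P j (P i c) \<bullet> b) * (P j c \<bullet> b))"
  proof (intro sum.cong refl)
    fix b c
    show "(P i (P j b) \<bullet> c) * (P j b \<bullet> c) = (P j (P i c) \<bullet> b) * (P j c \<bullet> b)"
      using sym_P[OF i, of "P j b" c] sym_P[OF j(1), of b "P i c"] sym_P[OF j(1), of b c]
      by (simp add: inner_commute)
  qed
  also have "\<dots> = (\<Sum>c\<in>Basis. \<Sum>b\<in>Basis. (P j (P i c) \<bullet> b) * (P j c \<bullet> b))"
    by (rule sum.swap)
  also have "\<dots> = (\<Sum>c\<in>Basis. P j (P i c) \<bullet> P j c)"
    by (intro sum.cong refl euclidean_inner[symmetric])
  also have "\<dots> = (\<Sum>c\<in>Basis. P i c \<bullet> c)"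
    using sym_P[OF j(1)] by (simp add: PP)
  finally have "(\<Sum>b\<in>Basis. P i (P j b) \<bullet> P j b) = (\<Sum>b\<in>Basis. P i b \<bullet> b)" .
  then show ?thesis by (simp add: neg sum_negf)
qed

lemma F_on_line:
  assumes "b \<in> Basis"
  shows "F (x + t *\<^sub>R b) = (x \<bullet> x + 2 * (x \<bullet> b) * t + t\<^sup>2)\<^sup>2
    - 2 * (\<Sum>i\<le>m. (P i x \<bullet> x + 2 * (P i x \<bullet> b) * t + (P i b \<bullet> b) * t\<^sup>2)\<^sup>2)"
proof -
  have "(x + t *\<^sub>R b) \<bullet> (x + t *\<^sub>R b) = x \<bullet> x + 2 * (x \<bullet> b) * t + t\<^sup>2"
    using assms by (simp add: inner_add_left inner_add_right inner_commute power2_eq_square)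
  moreover have "P i (x + t *\<^sub>R b) \<bullet> (x + t *\<^sub>R b) =
      P i x \<bullet> x + 2 * (P i x \<bullet> b) * t + (P i b \<bullet> b) * t\<^sup>2" if "i \<le> m" for i
    using that sym_P[of i b x]
    by (simp add: linear_add[OF linear_P] linear_cmul[OF linear_P] inner_add_left inner_add_right
      inner_commute power2_eq_square algebra_simps)
  ultimately show ?thesis
    by (simp add: clifford_polynomial_def atLeast0AtMost)
qed

text \<open>On a line in a coordinate direction \<open>F\<close> is a combination of squares of
  quadratic polynomials. Summed over the basis, the squared linear coefficients are handled by
  Parseval and the products with \<open>P i b \<bullet> b\<close> vanish by
  \<open>trace_P\<close>.\<close>

lemma laplacian_F:
  assumes m: "0 < m"
  shows "laplacian F x = (4 * real DIM('a) - 16 * real m - 8) * (x \<bullet> x)"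
proof -
  \<comment> \<open>The factor \<open>1\<close> is the quadratic coefficient of the norm square; it
    is written out so that \<open>sq\<close> and \<open>sq'\<close> match this term as well as those
    of the \<open>P i\<close>.\<close>
  let ?p = "\<lambda>b. (8 * (x \<bullet> b)\<^sup>2 + 4 * ((x \<bullet> x) * 1))
      - 2 * (\<Sum>i\<le>m. 8 * (P i x \<bullet> b)\<^sup>2 + 4 * ((P i x \<bullet> x) * (P i b \<bullet> b)))"
  have second: "(deriv ^^ 2) (\<lambda>t. F (x + t *\<^sub>R b)) 0 = ?p b" if b: "b \<in> Basis" for b
  proof -
    have funpow_2: "(deriv ^^ 2) f = deriv (deriv f)" for f :: "real \<Rightarrow> real"
      by (simp add: numeral_2_eq_2)
    have sq: "((\<lambda>t. (a + 2 * p * t + d * t\<^sup>2)\<^sup>2) has_real_derivative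
        4 * (a + 2 * p * t + d * t\<^sup>2) * (p + d * t)) (at t)" for a p d t :: real
      by (auto intro!: derivative_eq_intros simp: algebra_simps power2_eq_square)
    have sq': "((\<lambda>t. 4 * (a + 2 * p * t + d * t\<^sup>2) * (p + d * t)) has_real_derivative
        8 * p\<^sup>2 + 4 * (a * d)) (at 0)" for a p d :: real
      by (auto intro!: derivative_eq_intros simp: algebra_simps power2_eq_square)
    have F_on_line': "F (x + t *\<^sub>R b) = (x \<bullet> x + 2 * (x \<bullet> b) * t + 1 * t\<^sup>2)\<^sup>2
        - 2 * (\<Sum>i\<le>m. (P i x \<bullet> x + 2 * (P i x \<bullet> b) * t + (P i b \<bullet> b) * t\<^sup>2)\<^sup>2)" for t
      using F_on_line[OF b] by simp
    have 1: "deriv (\<lambda>t. F (x + t *\<^sub>R b)) =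
        (\<lambda>t. 4 * (x \<bullet> x + 2 * (x \<bullet> b) * t + 1 * t\<^sup>2) * (x \<bullet> b + 1 * t) -
        2 * (\<Sum>i\<le>m. 4 * (P i x \<bullet> x + 2 * (P i x \<bullet> b) * t + (P i b \<bullet> b) * t\<^sup>2) *
          (P i x \<bullet> b + (P i b \<bullet> b) * t)))"
      unfolding F_on_line'
      by (rule ext, rule DERIV_imp_deriv)
        (intro DERIV_diff DERIV_cmult DERIV_sum sq)
    show ?thesis
      unfolding funpow_2 1
      by (rule DERIV_imp_deriv)
        (intro DERIV_diff DERIV_cmult DERIV_sum sq')
  qed
  have parseval: "(\<Sum>b\<in>Basis. (y \<bullet> b)\<^sup>2) = y \<bullet> y" for y :: 'a
    using euclidean_inner[of y y] by (simp add: power2_eq_square)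
  have "(\<Sum>b\<in>Basis. \<Sum>i\<le>m. 8 * (P i x \<bullet> b)\<^sup>2 + 4 * ((P i x \<bullet> x) * (P i b \<bullet> b))) =
      (\<Sum>i\<le>m. 8 * (P i x \<bullet> P i x) + 4 * ((P i x \<bullet> x) * (\<Sum>b\<in>Basis. P i b \<bullet> b)))"
    by (subst sum.swap) (simp add: sum.distrib sum_distrib_left flip: parseval)
  also have "\<dots> = 8 * (real m + 1) * (x \<bullet> x)"
    by (simp add: trace_P[OF m] P_inner_P)
  finally have P_part: "(\<Sum>b\<in>Basis. \<Sum>i\<le>m. 8 * (P i x \<bullet> b)\<^sup>2 + 4 * ((P i x \<bullet> x) * (P i b \<bullet> b))) =
    8 * (real m + 1) * (x \<bullet> x)" .
  have "laplacian F x = (\<Sum>b\<in>Basis. ?p b)"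
    unfolding laplacian_def by (intro sum.cong refl second)
  also have "\<dots> = (\<Sum>b\<in>Basis. 8 * (x \<bullet> b)\<^sup>2 + 4 * ((x \<bullet> x) * 1)) - 2 * (8 * (real m + 1) * (x \<bullet> x))"
    unfolding P_part[symmetric] sum_subtractf sum_distrib_left[of 2 _ Basis] ..
  also have "\<dots> = 8 * (x \<bullet> x) + 4 * real DIM('a) * (x \<bullet> x) - 2 * (8 * (real m + 1) * (x \<bullet> x))"
    by (simp add: sum.distrib parseval flip: sum_distrib_left)
  finally show ?thesis by (simp add: algebra_simps)
qed

section \<open>The gradient on the sphere and the unit normal field\<close>

lemma sphere_grad_F:
  assumes "norm y = 1"
  shows "sphere_grad F y = 4 *\<^sub>R (y - 2 *\<^sub>R comb (cf y) y - F y *\<^sub>R y)"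
proof -
  have "sphere_grad F y = gradF y - (4 * F y) *\<^sub>R y"
    using sphere_grad_eq_tangential_part[OF assms F_has_derivative] by (simp add: gradF_inner_self)
  then show ?thesis
    using assms by (simp add: gradF_def norm_eq_1 scaleR_diff_right)
qed

text \<open>Pythagoras: a gradient of length 4 loses its radial part \<open>4 * F y\<close>.\<close>

lemma norm_sphere_grad_F:
  assumes "norm y = 1"
  shows "norm (sphere_grad F y) = 4 * sqrt (1 - (F y)\<^sup>2)"
proof -
  have y: "y \<bullet> y = 1" using assms by (simp add: norm_eq_1)
  have "sphere_grad F y = gradF y - (4 * F y) *\<^sub>R y"
    using sphere_grad_eq_tangential_part[OF assms F_has_derivative] by (simp add: gradF_inner_self)
  then have "(norm (sphere_grad F y))\<^sup>2 = (norm (gradF y))\<^sup>2 - 16 * (F y)\<^sup>2"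
    unfolding power2_norm_eq_inner
    by (simp add: inner_diff_left inner_diff_right gradF_inner_self y inner_commute[of y "gradF y"]
      power2_eq_square)
  also have "\<dots> = 4\<^sup>2 * (1 - (F y)\<^sup>2)"
    using norm_grad_F[of y] assms by (simp add: grad_F)
  finally have "norm (sphere_grad F y) = sqrt (4\<^sup>2 * (1 - (F y)\<^sup>2))"
    by (metis norm_ge_zero real_sqrt_unique)
  then show ?thesis by (simp only: real_sqrt_mult real_sqrt_abs abs_numeral)
qed

text \<open>The formula for the unit normal on the sphere, read on the whole space, so that ordinary
  derivatives are available.\<close>

definition normal_field :: "'a \<Rightarrow> 'a" where
  "normal_field y = inverse (sqrt (1 - (F y)\<^sup>2)) *\<^sub>R (y - 2 *\<^sub>R comb (cf y) y - F y *\<^sub>R y)"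

lemma unit_normal_eq_normal_field:
  assumes "norm y = 1"
  shows "unit_normal F y = normal_field y"
  using assms by (simp add: unit_normal_def norm_sphere_grad_F) (simp add: sphere_grad_F normal_field_def)

text \<open>The formula for \<open>D\<close> is restricted to \<open>h\<close> orthogonal to the
  gradient, which includes all tangent vectors of the level. For them the derivatives of
  \<open>F\<close> and of the scalar factor vanish, so mere existence of the number \<open>K\<close>
  below suffices.\<close>

lemma normal_field_has_derivative:
  assumes x: "\<bar>F x\<bar> < 1"
  obtains D where "(normal_field has_derivative D) (at x)"
    and "\<And>h. gradF x \<bullet> h = 0 \<Longrightarrow> D h = inverse (sqrt (1 - (F x)\<^sup>2)) *\<^sub>R
      (h - 4 *\<^sub>R (\<Sum>i\<le>m. (P i x \<bullet> h) *\<^sub>R P i x) - 2 *\<^sub>R comb (cf x) h - F x *\<^sub>R h)"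
proof -
  have "(F x)\<^sup>2 < 1" using x by (simp add: abs_square_less_1)
  then have "\<exists>K. ((\<lambda>c. inverse (sqrt (1 - c\<^sup>2))) has_real_derivative K) (at (F x))"
    by (intro exI) (rule derivative_eq_intros refl | simp)+
  then obtain K where K: "((\<lambda>c. inverse (sqrt (1 - c\<^sup>2))) has_real_derivative K) (at (F x))" ..
  have k: "((\<lambda>y. inverse (sqrt (1 - (F y)\<^sup>2))) has_derivative (\<lambda>h. K * (gradF x \<bullet> h))) (at x)"
    using has_derivative_compose[OF F_has_derivative K[unfolded has_field_derivative_def]] by simp
  have comb: "((\<lambda>y. comb (cf y) y) has_derivative
      (\<lambda>h. \<Sum>i\<le>m. (P i x \<bullet> x) *\<^sub>R P i h + (2 * (P i x \<bullet> h)) *\<^sub>R P i x)) (at x)"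
    unfolding comb_def
    by (intro has_derivative_sum has_derivative_scaleR cf_has_derivative P_has_derivative) auto
  let ?G = "\<lambda>y. y - 2 *\<^sub>R comb (cf y) y - F y *\<^sub>R y"
  let ?DG = "\<lambda>h. h - 2 *\<^sub>R (\<Sum>i\<le>m. (P i x \<bullet> x) *\<^sub>R P i h + (2 * (P i x \<bullet> h)) *\<^sub>R P i x) -
    (F x *\<^sub>R h + (gradF x \<bullet> h) *\<^sub>R x)"
  have D: "(normal_field has_derivative
      (\<lambda>h. inverse (sqrt (1 - (F x)\<^sup>2)) *\<^sub>R ?DG h + (K * (gradF x \<bullet> h)) *\<^sub>R ?G x)) (at x)"
    unfolding normal_field_def[abs_def]
    by (intro has_derivative_scaleR k has_derivative_diff comb has_derivative_scaleR_right
      F_has_derivative has_derivative_ident)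
  have DG: "?DG h = h - 4 *\<^sub>R (\<Sum>i\<le>m. (P i x \<bullet> h) *\<^sub>R P i x) - 2 *\<^sub>R comb (cf x) h - F x *\<^sub>R h"
    if "gradF x \<bullet> h = 0" for h
    using that by (simp add: sum.distrib comb_def scaleR_add_right scaleR_sum_right)
  show ?thesis
  proof (rule that[OF D])
    fix h assume h: "gradF x \<bullet> h = 0"
    show "inverse (sqrt (1 - (F x)\<^sup>2)) *\<^sub>R ?DG h + (K * (gradF x \<bullet> h)) *\<^sub>R ?G x =
        inverse (sqrt (1 - (F x)\<^sup>2)) *\<^sub>R
        (h - 4 *\<^sub>R (\<Sum>i\<le>m. (P i x \<bullet> h) *\<^sub>R P i x) - 2 *\<^sub>R comb (cf x) h - F x *\<^sub>R h)"
      unfolding DG[OF h] by (simp add: h)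
  qed
qed

lemma unit_normal_has_derivative:
  assumes x: "norm x = 1" "\<bar>F x\<bar> < 1" and D: "(normal_field has_derivative D) (at x)"
  shows "(unit_normal F has_derivative D) (at x within sphere 0 1)"
  by (rule has_derivative_transform[OF _ _ has_derivative_at_withinI[OF D]])
    (use x in \<open>auto simp: unit_normal_eq_normal_field\<close>)

end

subsection \<open>Normal geodesics\<close>

text \<open>Here s = sin \<psi> and c = cos \<psi>, and \<open>q\<close> is the direction of the
  vector of all \<open>P i x \<bullet> x\<close>. Since \<open>s\<close> and \<open>c\<close> are
  parameters, results that mention only them hold uniformly on a level.\<close>

locale clifford_point = clifford +
  fixes x :: 'a and q :: "nat \<Rightarrow> real" and s c :: real
  assumes x: "x \<bullet> x = 1" and s: "0 < s" and c: "0 < c" and sc: "s\<^sup>2 + c\<^sup>2 = 1"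
    and q: "ip q q = 1" and cf_x: "i \<le> m \<Longrightarrow> P i x \<bullet> x = s * q i"
begin

abbreviation Q :: "'a \<Rightarrow> 'a" where "Q \<equiv> comb q"

definition nu :: 'a where "nu = (s *\<^sub>R x - Q x) /\<^sub>R c"

lemma norm_x: "norm x = 1"
  using x by (simp add: norm_eq_1)

lemma c2: "c\<^sup>2 = 1 - s\<^sup>2"
  using sc by simp

lemma Q_Q: "Q (Q y) = y"
  by (simp add: comb_comb_self q)

lemma comb_x_inner: "comb r x \<bullet> x = s * ip r q"
  by (simp add: comb_inner cf_x ip_def sum_distrib_left mult_ac)

lemma Q_x_inner: "Q x \<bullet> x = s"
  by (simp add: comb_x_inner q)

lemma comb_cf: "comb (cf x) y = s *\<^sub>R Q y"
  by (simp add: comb_def cf_x scaleR_sum_right)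

lemma F_x: "F x = 1 - 2 * s\<^sup>2"
proof -
  have "ip (cf x) (cf x) = s\<^sup>2 * ip q q"
    by (simp add: ip_def cf_x sum_distrib_left power2_eq_square mult_ac)
  then show ?thesis by (simp add: F_eq x q)
qed

lemma sqrt_F_x: "sqrt (1 - (F x)\<^sup>2) = 2 * s * c"
proof -
  have "1 - (F x)\<^sup>2 = (2 * s * c)\<^sup>2"
    unfolding power_mult_distrib c2 F_x by (simp add: power2_eq_square algebra_simps)
  then show ?thesis using s c by simp
qed

lemma F_x_less_1: "\<bar>F x\<bar> < 1"
proof -
  have "0 < s\<^sup>2" "0 < c\<^sup>2" using s c by auto
  then show ?thesis using sc unfolding F_x by linarith
qed

lemma normal_x: "x - 2 *\<^sub>R comb (cf x) x - F x *\<^sub>R x = (2 * s * c) *\<^sub>R nu"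
proof -
  have "(2 * s * c) *\<^sub>R nu = (2 * s) *\<^sub>R (s *\<^sub>R x - Q x)"
    using c by (simp add: nu_def)
  then show ?thesis
    by (simp add: comb_cf F_x power2_eq_square algebra_simps scaleR_2)
qed

lemma unit_normal_x: "unit_normal F x = nu"
proof -
  have "2 * s * c \<noteq> 0" using s c by simp
  then show ?thesis
    unfolding unit_normal_eq_normal_field[OF norm_x] normal_field_def normal_x sqrt_F_x
    by (simp only: scaleR_scaleR left_inverse[OF \<open>2 * s * c \<noteq> 0\<close>] scaleR_one)
qed

lemma Q_x: "Q x = s *\<^sub>R x - c *\<^sub>R nu"
  using c by (simp add: nu_def)

lemma Q_nu: "Q nu = - c *\<^sub>R x - s *\<^sub>R nu"
proof -
  have "c *\<^sub>R Q nu = s *\<^sub>R Q x - x"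
    using c by (simp add: nu_def comb_simps Q_Q)
  also have "\<dots> = (s\<^sup>2 - 1) *\<^sub>R x - (s * c) *\<^sub>R nu"
    by (simp add: Q_x algebra_simps power2_eq_square)
  also have "s\<^sup>2 - 1 = - c * c"
    using sc by (simp add: power2_eq_square)
  finally have "c *\<^sub>R Q nu = c *\<^sub>R (- c *\<^sub>R x - s *\<^sub>R nu)"
    by (simp add: algebra_simps)
  then show ?thesis using c by simp
qed

lemma nu_x: "nu \<bullet> x = 0"
  by (simp add: nu_def inner_diff_left Q_x_inner x)

lemma nu_nu: "nu \<bullet> nu = 1"
proof -
  have "(s *\<^sub>R x - Q x) \<bullet> (s *\<^sub>R x - Q x) = c * c"
    using c2 by (simp add: inner_diff_left inner_diff_right x comb_inner_comb q Q_x_inner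
      inner_commute[of x "Q x"] power2_eq_square)
  then show ?thesis using c by (simp add: nu_def) (simp add: field_simps)
qed

text \<open>With \<open>cf_x\<close> and \<open>P_nu_nu\<close> this says that on the plane of
  \<open>x\<close> and \<open>nu\<close> the quadratic form of \<open>P i\<close> is
  \<open>q i\<close> times that of \<open>Q\<close>; this is why \<open>q\<close> is constant along
  the geodesic.\<close>

lemma P_x_nu: "i \<le> m \<Longrightarrow> P i x \<bullet> nu = - c * q i"
proof -
  assume i: "i \<le> m"
  have "c * (P i x \<bullet> nu) = s * (s * q i) - q i"
    using c i by (simp add: nu_def inner_diff_right cf_x P_inner_comb x)
  also have "\<dots> = c * (- c * q i)"
    using c2 by algebra
  finally show ?thesis using c by (metis mult_left_cancel less_irrefl mult_pos_pos)
qed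

lemma P_nu_nu: "i \<le> m \<Longrightarrow> P i nu \<bullet> nu = - s * q i"
proof -
  assume i: "i \<le> m"
  \<comment> \<open>Conjugation by \<open>Q\<close> turns \<open>P i\<close> into 2
    \<open>q i\<close> Q - \<open>P i\<close>, whose form at \<open>x\<close> is known.\<close>
  have "P i (Q x) \<bullet> Q x = (2 * q i) * (Q x \<bullet> x) - P i x \<bullet> x"
  proof -
    have "P i (Q x) = (2 * q i) *\<^sub>R x - Q (P i x)"
      using anti_comb[of "\<lambda>k. if k = i then 1 else 0" q x] i
      by (simp add: comb_delta ip_delta eq_diff_eq)
    then show ?thesis
      by (simp add: inner_diff_left sym_comb[of q "P i x"] Q_Q inner_commute[of x "Q x"])
  qed
  then have PQ: "P i (Q x) \<bullet> Q x = s * q i"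
    using i by (simp add: Q_x_inner cf_x)
  have c_nu: "c *\<^sub>R nu = s *\<^sub>R x - Q x" using Q_x by simp
  have "c * c * (P i nu \<bullet> nu) = P i (c *\<^sub>R nu) \<bullet> (c *\<^sub>R nu)"
    using i by (simp add: linear_cmul[OF linear_P])
  also have "\<dots> = s * s * (P i x \<bullet> x) - 2 * s * (P i x \<bullet> Q x) + P i (Q x) \<bullet> Q x"
    unfolding c_nu using i sym_P[OF i, of "Q x" x]
    by (simp add: linear_diff[OF linear_P] linear_cmul[OF linear_P] inner_diff_left
      inner_diff_right inner_commute[of "Q x"] algebra_simps)
  also have "\<dots> = s * s * (s * q i) - 2 * s * q i + s * q i"
    using i by (simp add: PQ cf_x P_inner_comb x)
  also have "\<dots> = c * c * (- s * q i)"
    using c2 by algebra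
  finally show ?thesis using c by (metis mult_left_cancel less_irrefl mult_pos_pos)
qed

text \<open>Moving along the normal geodesic through \<open>x = x(\<psi>)\<close>, \<open>s = sin \<psi>\<close>, \<open>c = cos \<psi>\<close>,
  changes \<open>\<psi>\<close> into \<open>\<psi> - 2 t\<close> and leaves \<open>q\<close> fixed.\<close>

context
  fixes t :: real
begin

definition "geo = cos t *\<^sub>R x + sin t *\<^sub>R nu"
definition "geo' = cos t *\<^sub>R nu - sin t *\<^sub>R x"
text \<open>These are sin (\<psi> - 2 t) and cos (\<psi> - 2 t), expanded by the addition formulas.
  Unlike \<open>s\<close> and \<open>c\<close> they may be zero or negative.\<close>

definition "sg = s * cos (2 * t) - c * sin (2 * t)"
definition "cg = c * cos (2 * t) + s * sin (2 * t)"

lemma geo_unit: "geo \<bullet> geo = 1"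
  by (simp add: geo_def inner_add_left inner_add_right x nu_nu nu_x inner_commute[of x nu]
    flip: power2_eq_square)

lemma cf_geo: "i \<le> m \<Longrightarrow> P i geo \<bullet> geo = sg * q i"
proof -
  assume i: "i \<le> m"
  have "P i geo \<bullet> geo = cos t * cos t * (P i x \<bullet> x) + 2 * sin t * cos t * (P i x \<bullet> nu)
      + sin t * sin t * (P i nu \<bullet> nu)"
    using i sym_P[OF i, of nu x]
    by (simp add: geo_def linear_add[OF linear_P] linear_cmul[OF linear_P] inner_add_left
      inner_add_right inner_commute[of nu] algebra_simps)
  also have "\<dots> = sg * q i"
    using i unfolding sg_def cos_double sin_double
    by (simp add: cf_x P_x_nu P_nu_nu power2_eq_square algebra_simps)
  finally show ?thesis .
qed

lemma sg_cg: "sg\<^sup>2 + cg\<^sup>2 = 1"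
proof -
  have "sg\<^sup>2 + cg\<^sup>2 = (s\<^sup>2 + c\<^sup>2) * ((sin (2 * t))\<^sup>2 + (cos (2 * t))\<^sup>2)"
    unfolding sg_def cg_def by (simp only: power2_eq_square) (simp only: algebra_simps)
  then show ?thesis by (simp add: sc)
qed

lemma F_geo: "F geo = 1 - 2 * sg\<^sup>2"
proof -
  have "ip (cf geo) (cf geo) = sg\<^sup>2 * ip q q"
    by (simp add: ip_def cf_geo sum_distrib_left power2_eq_square mult_ac)
  then show ?thesis by (simp add: F_eq geo_unit q)
qed

lemma comb_cf_geo: "comb (cf geo) y = sg *\<^sub>R Q y"
  by (simp add: comb_def cf_geo scaleR_sum_right)

text \<open>The relation \<open>Q_x\<close>, transported along the geodesic; it comes from the
  reflection formulas by writing t as 2 t - t.\<close>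

lemma Q_geo: "Q geo = sg *\<^sub>R geo - cg *\<^sub>R geo'"
proof -
  have e: "Q geo = (cos t * s - sin t * c) *\<^sub>R x - (cos t * c + sin t * s) *\<^sub>R nu"
    by (simp add: geo_def comb_simps Q_x Q_nu algebra_simps)
  have "cos t * s - sin t * c = sg * cos t + cg * sin t"
    using cos_diff[of "2 * t" t] sin_diff[of "2 * t" t] by (simp add: sg_def cg_def) algebra
  moreover have "cos t * c + sin t * s = cg * cos t - sg * sin t"
    using cos_diff[of "2 * t" t] sin_diff[of "2 * t" t] by (simp add: sg_def cg_def) algebra
  ultimately have "Q geo = (sg * cos t + cg * sin t) *\<^sub>R x - (cg * cos t - sg * sin t) *\<^sub>R nu"
    using e by (simp only:)
  then show ?thesis
    by (simp only: geo_def geo'_def) (simp add: algebra_simps)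
qed

text \<open>The normal points to increasing \<open>F\<close>, whereas along the geodesic F = cos (2
  \<psi> - 4 t), with derivative \<open>8 * (sg * cg)\<close>. Hence the sign.\<close>

lemma normal_geo:
  assumes "sg * cg \<noteq> 0"
  shows "unit_normal F geo = sgn (sg * cg) *\<^sub>R geo'"
proof -
  have "1 - (F geo)\<^sup>2 = (2 * (sg * cg))\<^sup>2"
    using sg_cg unfolding F_geo by algebra
  then have "sqrt (1 - (F geo)\<^sup>2) = 2 * \<bar>sg * cg\<bar>"
    by (simp only: real_sqrt_abs abs_mult abs_numeral)
  moreover have "geo - 2 *\<^sub>R comb (cf geo) geo - F geo *\<^sub>R geo = (2 * (sg * cg)) *\<^sub>R geo'"
    by (simp add: comb_cf_geo Q_geo F_geo power2_eq_square algebra_simps)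
  ultimately have "unit_normal F geo = inverse (2 * \<bar>sg * cg\<bar>) *\<^sub>R (2 * (sg * cg)) *\<^sub>R geo'"
    using geo_unit by (simp add: unit_normal_eq_normal_field norm_eq_1 normal_field_def)
  moreover have "inverse (2 * \<bar>a\<bar>) * (2 * a) = sgn a" for a :: real
    by (simp add: sgn_if abs_if)
  ultimately show ?thesis by (simp only: scaleR_scaleR)
qed

end

subsection \<open>The shape operator\<close>

definition tangent :: "'a set" where
  "tangent = {v. v \<bullet> x = 0 \<and> v \<bullet> Q x = 0}"

lemma sphere_grad_x: "sphere_grad F x = (8 * s * c) *\<^sub>R nu"
  using sphere_grad_F[OF norm_x] normal_x by simp

lemma level_tangent_x: "level_tangent F x = tangent"
proof -
  have "v \<bullet> sphere_grad F x = (8 * s) * (s * (v \<bullet> x) - v \<bullet> Q x)" for v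
    using c by (simp add: sphere_grad_x nu_def inner_diff_right)
  then show ?thesis
    using s by (auto simp: level_tangent_def tangent_def)
qed

text \<open>The vectors \<open>P i x\<close> are orthonormal by \<open>P_inner_P\<close>, so this is
  the orthogonal projection onto their span.\<close>

definition W_proj :: "'a \<Rightarrow> 'a" where
  "W_proj v = (\<Sum>i\<le>m. (P i x \<bullet> v) *\<^sub>R P i x)"

definition S_op :: "'a \<Rightarrow> 'a" where
  "S_op v = Q v + (2 / s) *\<^sub>R W_proj v - s *\<^sub>R v"

lemma W_proj_inner: "W_proj v \<bullet> w = (\<Sum>i\<le>m. (P i x \<bullet> v) * (P i x \<bullet> w))"
  by (simp add: W_proj_def inner_sum_left)

lemma unit_normal_differentiable: "unit_normal F differentiable (at x within sphere 0 1)"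
proof -
  obtain D where "(normal_field has_derivative D) (at x)"
    by (rule normal_field_has_derivative[OF F_x_less_1]) (rule that)
  then show ?thesis
    unfolding differentiable_def by (intro exI unit_normal_has_derivative[OF norm_x F_x_less_1])
qed

lemma shape_operator_x:
  assumes v: "v \<in> tangent"
  shows "shape_operator F x v = S_op v /\<^sub>R c"
proof -
  have v_x: "v \<bullet> x = 0" and v_Q: "v \<bullet> Q x = 0"
    using v by (auto simp: tangent_def)
  obtain D where D: "(normal_field has_derivative D) (at x)"
    and D_eq: "\<And>h. gradF x \<bullet> h = 0 \<Longrightarrow> D h = inverse (sqrt (1 - (F x)\<^sup>2)) *\<^sub>R
      (h - 4 *\<^sub>R (\<Sum>i\<le>m. (P i x \<bullet> h) *\<^sub>R P i x) - 2 *\<^sub>R comb (cf x) h - F x *\<^sub>R h)"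
    by (rule normal_field_has_derivative[OF F_x_less_1]) (rule that)
  note deriv = unit_normal_has_derivative[OF norm_x F_x_less_1 D]
  let ?f = "frechet_derivative (unit_normal F) (at x within sphere 0 1)"
  have "(unit_normal F has_derivative ?f) (at x within sphere 0 1)"
    using unit_normal_differentiable by (simp add: frechet_derivative_works)
  \<comment> \<open>\<open>frechet_derivative\<close> is some derivative within the sphere; its
    value is pinned down because \<open>v\<close> is tangent.\<close>
  then have "?f v = D v"
    by (rule sphere_derivative_unique[OF norm_x v_x _ deriv])
  also have "\<dots> = inverse (2 * s * c) *\<^sub>R
      (v - 4 *\<^sub>R W_proj v - 2 *\<^sub>R s *\<^sub>R Q v - (1 - 2 * s\<^sup>2) *\<^sub>R v)"
  proof -
    have "gradF x \<bullet> v = 0"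
      using v_x v_Q
      by (simp add: gradF_def comb_cf inner_diff_left inner_commute[of x v] inner_commute[of "Q x" v])
    then show ?thesis
      unfolding D_eq[OF \<open>gradF x \<bullet> v = 0\<close>] sqrt_F_x comb_cf W_proj_def
      by (simp only: F_x)
  qed
  also have "v - 4 *\<^sub>R W_proj v - 2 *\<^sub>R s *\<^sub>R Q v - (1 - 2 * s\<^sup>2) *\<^sub>R v = (2 * s) *\<^sub>R (- S_op v)"
    using s by (simp add: S_op_def algebra_simps power2_eq_square)
  also have "inverse (2 * s * c) *\<^sub>R (2 * s) *\<^sub>R (- S_op v) = - (S_op v /\<^sub>R c)"
    using s c by (simp add: field_simps)
  finally have f: "?f v = - (S_op v /\<^sub>R c)" .
  \<comment> \<open>The derivative is already tangent to the sphere, so the projection in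
    \<open>shape_operator\<close> changes nothing.\<close>
  have "W_proj v \<bullet> x = s * (Q x \<bullet> v)"
    by (simp add: W_proj_inner cf_x comb_inner sum_distrib_left mult_ac)
  then have "S_op v \<bullet> x = 0"
    using v_x v_Q sym_comb[of q v x]
    by (simp add: S_op_def inner_add_left inner_diff_left inner_commute[of "Q x" v])
  then show ?thesis
    by (simp add: shape_operator_def f)
qed

lemma S_op_sym: "S_op v \<bullet> w = v \<bullet> S_op w"
proof -
  have "W_proj v \<bullet> w = v \<bullet> W_proj w"
    unfolding inner_commute[of v] W_proj_inner by (simp add: mult.commute)
  then show ?thesis
    by (simp add: S_op_def inner_add_left inner_add_right inner_diff_left inner_diff_right sym_comb)
qed

section \<open>Eigenspaces of the shape operator and lower bounds for their dimensions\<close>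

definition eigenspace :: "real \<Rightarrow> 'a set" where
  "eigenspace \<kappa> = {v \<in> tangent. S_op v = (c * \<kappa>) *\<^sub>R v}"

lemma eigenspace_eq: "eigenspace \<kappa> = {v \<in> tangent. S_op v /\<^sub>R c = \<kappa> *\<^sub>R v}"
proof -
  have "S_op v /\<^sub>R c = \<kappa> *\<^sub>R v \<longleftrightarrow> S_op v = (c * \<kappa>) *\<^sub>R v" for v
  proof
    assume "S_op v /\<^sub>R c = \<kappa> *\<^sub>R v"
    then have "c *\<^sub>R (S_op v /\<^sub>R c) = c *\<^sub>R \<kappa> *\<^sub>R v" by simp
    then show "S_op v = (c * \<kappa>) *\<^sub>R v" using c by simp
  qed (use c in simp)
  then show ?thesis
    by (simp only: eigenspace_def)
qed

lemma shape_eigenspace: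
  "{v \<in> level_tangent F x. shape_operator F x v = \<kappa> *\<^sub>R v} = eigenspace \<kappa>"
  unfolding eigenspace_eq level_tangent_x
  by (intro Collect_cong conj_cong refl) (simp only: shape_operator_x)

lemma curvature_multiplicity_x: "curvature_multiplicity F x \<kappa> = dim (eigenspace \<kappa>)"
  by (simp add: curvature_multiplicity_def shape_eigenspace)

lemma principal_curvatures_x: "principal_curvatures F x = {\<kappa>. dim (eigenspace \<kappa>) \<noteq> 0}"
  unfolding principal_curvatures_def shape_eigenspace[symmetric] by auto

lemma dim_tangent: "dim tangent + 2 \<le> DIM('a)"
proof -
  have "dim (tangent \<union> {x, nu}) = dim tangent + dim {x, nu}"
    by (rule dim_orthogonal_sum) (auto simp: tangent_def nu_def inner_diff_right)
  moreover have "dim {x, nu} = 2"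
  proof -
    have "x \<noteq> nu" "x \<noteq> 0" "nu \<noteq> 0"
      using x nu_nu nu_x by auto
    then have "independent {x, nu}"
      by (intro pairwise_orthogonal_independent)
        (auto simp: pairwise_def orthogonal_def nu_x inner_commute[of x nu])
    then show ?thesis
      using \<open>x \<noteq> nu\<close> by (simp add: dim_eq_card_independent)
  qed
  ultimately show ?thesis
    using dim_subset_UNIV[of "tangent \<union> {x, nu}"] by simp
qed

lemma Q_eigenvectors_ge:
  assumes \<sigma>: "\<sigma> = 1 \<or> \<sigma> = - 1"
  shows "dim {v. Q v = \<sigma> *\<^sub>R v} \<le> dim (eigenspace ((\<sigma> - s) / c)) + (m + 1)"
proof -
  let ?S = "{v. Q v = \<sigma> *\<^sub>R v}"
  have "\<exists>j\<le>m. q j \<noteq> 0"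
    using q by (rule contrapos_pp) (auto simp: ip_def)
  then obtain j where j: "j \<le> m" "q j \<noteq> 0" by auto
  \<comment> \<open>One index \<open>j\<close> with \<open>q j \<noteq> 0\<close> is left out. For
    an eigenvector of \<open>Q\<close>, orthogonality to \<open>x\<close> implies orthogonality to
    \<open>Q x\<close>, the combination of the \<open>P i x\<close> with coefficients
    \<open>q i\<close>, and so supplies the missing condition. This keeps the number of conditions
    at \<open>m + 1\<close>.\<close>
  let ?Y = "insert x ((\<lambda>i. P i x) ` ({..m} - {j}))"
  have "subspace ?S"
    by (auto simp: subspace_def comb_simps linear_0[OF linear_comb] scaleR_add_right)
  then have "dim ?S \<le> dim {v \<in> ?S. \<forall>y\<in>?Y. v \<bullet> y = 0} + card ?Y"
    by (rule dim_orthogonal_within_ge) auto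
  moreover have "card ?Y \<le> m + 1"
    using card_image_le[of "{..m} - {j}" "\<lambda>i. P i x"] j by (simp add: card_insert_if)
  moreover have "{v \<in> ?S. \<forall>y\<in>?Y. v \<bullet> y = 0} \<subseteq> eigenspace ((\<sigma> - s) / c)"
  proof
    fix v assume "v \<in> {v \<in> ?S. \<forall>y\<in>?Y. v \<bullet> y = 0}"
    then have Qv: "Q v = \<sigma> *\<^sub>R v" and vx: "v \<bullet> x = 0"
      and vP: "\<And>i. i \<le> m \<Longrightarrow> i \<noteq> j \<Longrightarrow> P i x \<bullet> v = 0"
      by (auto simp: inner_commute)
    have v_Qx: "Q x \<bullet> v = 0"
      using sym_comb[of q x v] vx by (simp add: Qv inner_commute)
    have "Q x \<bullet> v = q j * (P j x \<bullet> v)"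
      unfolding comb_inner using j vP by (subst sum.remove[of _ j]) (auto intro: sum.neutral)
    then have "P i x \<bullet> v = 0" if "i \<le> m" for i
      using vP[OF that] v_Qx j by (cases "i = j") auto
    then have "W_proj v = 0"
      by (simp add: W_proj_def)
    then show "v \<in> eigenspace ((\<sigma> - s) / c)"
      using vx v_Qx c
      by (simp add: eigenspace_def tangent_def S_op_def Qv inner_commute scaleR_diff_left)
  qed
  then have "dim {v \<in> ?S. \<forall>y\<in>?Y. v \<bullet> y = 0} \<le> dim (eigenspace ((\<sigma> - s) / c))"
    by (rule dim_subset)
  ultimately show ?thesis by linarith
qed

lemma dim_span_P: "dim (span ((\<lambda>i. P i x) ` {..m})) = m + 1"
proof -
  have inj: "inj_on (\<lambda>i. P i x) {..m}"
  proof (rule inj_onI)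
    fix i j assume "i \<in> {..m}" "j \<in> {..m}" "P i x = P j x"
    then show "i = j"
      using P_inner_P[of i i x] P_inner_P[of i j x] x by (auto split: if_splits)
  qed
  have "independent ((\<lambda>i. P i x) ` {..m})"
  proof (rule pairwise_orthogonal_independent)
    show "pairwise orthogonal ((\<lambda>i. P i x) ` {..m})"
      by (auto simp: pairwise_def orthogonal_def P_inner_P)
    show "0 \<notin> (\<lambda>i. P i x) ` {..m}"
    proof
      assume "0 \<in> (\<lambda>i. P i x) ` {..m}"
      then obtain i where "i \<le> m" "P i x = 0" by auto
      then show False using P_inner_P[of i i x] x by simp
    qed
  qed
  then show ?thesis
    using inj by (simp add: dim_eq_card_independent card_image)
qed

text \<open>Moving \<open>P i\<close> to the front of the product of \<open>comb r\<close>,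
  \<open>Q\<close> and \<open>P i\<close> reproduces the unknown with the opposite sign. The
  consequence is that \<open>W_proj (Q w)\<close> is \<open>- s\<close> times \<open>w\<close> for
  \<open>w\<close> in W orthogonal to \<open>Q x\<close>, so \<open>S_op\<close> preserves the span
  of \<open>w\<close> and \<open>Q w\<close>.\<close>

lemma P_inner_Q_comb:
  assumes i: "i \<le> m" and r: "ip r q = 0"
  shows "P i x \<bullet> Q (comb r x) = - s * r i"
proof -
  have "comb r (P i y) = (2 * r i) *\<^sub>R y - P i (comb r y)" for y
    using anti_comb[of "\<lambda>k. if k = i then 1 else 0" r y] i
    by (simp add: comb_delta ip_delta eq_diff_eq add.commute)
  note rP = this
  have "Q (P i y) = (2 * q i) *\<^sub>R y - P i (Q y)" for y
    using anti_comb[of "\<lambda>k. if k = i then 1 else 0" q y] i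
    by (simp add: comb_delta ip_delta eq_diff_eq add.commute)
  note qP = this
  have rq: "comb r (Q y) = - Q (comb r y)" for y
    using anti_comb[of r q y] r by (simp add: eq_neg_iff_add_eq_0)
  have "P i x \<bullet> Q (comb r x) = comb r (Q (P i x)) \<bullet> x"
    by (simp add: sym_comb)
  also have "comb r (Q (P i x)) = (2 * q i) *\<^sub>R comb r x - (2 * r i) *\<^sub>R Q x - P i (Q (comb r x))"
    by (simp add: qP comb_simps rP rq linear_neg[OF linear_P[OF i]])
  also have "\<dots> \<bullet> x = - 2 * s * r i - P i x \<bullet> Q (comb r x)"
    using sym_P[OF i, of "Q (comb r x)" x]
    by (simp add: inner_diff_left comb_x_inner r q inner_commute[of "Q (comb r x)"])
  finally show ?thesis by simp
qed

lemma W_eigenvectors_ge: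
  assumes \<sigma>: "\<sigma> = 1 \<or> \<sigma> = - 1"
  shows "m \<le> dim (eigenspace ((c + \<sigma>) / s))"
proof -
  \<comment> \<open>On the span of \<open>w\<close> and \<open>Q w\<close> one has S w = (2/s - s) w
    + Q w and S (Q w) = - w - s Q w. Thus \<mu> w + Q w is an eigenvector, with eigenvalue \<mu> -
    s, iff \<mu>^2 + 1 = 2 \<mu> / s; the roots are (1 + c) / s and (1 - c) / s.\<close>
  define \<mu> where "\<mu> = (1 + \<sigma> * c) / s"
  define ev where "ev = c * ((c + \<sigma>) / s)"
  have ev: "ev = \<mu> - s"
    using s c2 \<sigma> unfolding ev_def \<mu>_def by (auto simp: field_simps power2_eq_square)
  have \<mu>: "\<mu>\<^sup>2 + 1 = 2 * \<mu> / s"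
    using s c2 \<sigma> unfolding \<mu>_def by (auto simp: field_simps power2_eq_square)
  \<comment> \<open>For \<sigma> = - 1 the eigenvalue \<open>ev\<close> would vanish at c = 1. It
    has to be nonzero because the inner product of \<open>L w\<close> with \<open>w\<close> is
    \<open>ev * (w \<bullet> w)\<close>, which makes \<open>L\<close> injective.\<close>
  have "c \<noteq> 1"
    using sc s by auto
  then have ev_0: "ev \<noteq> 0"
    using s c \<sigma> by (auto simp: ev_def)
  \<comment> \<open>Orthogonality to \<open>Q x\<close> makes \<open>L w\<close> tangent and costs
    one of the \<open>m + 1\<close> dimensions.\<close>
  let ?W = "{w \<in> span ((\<lambda>i. P i x) ` {..m}). \<forall>y\<in>{Q x}. w \<bullet> y = 0}"
  define L where "L w = \<mu> *\<^sub>R w + Q w" for w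
  have L: "linear L"
    unfolding L_def by (intro linear_compose_add linear_scale_self linear_comb)
  have W: "subspace ?W"
    by (intro subspaceI) (auto simp: span_zero span_add span_scale inner_add_left)
  have "m + 1 \<le> dim ?W + 1"
    using dim_orthogonal_within_ge[of "span ((\<lambda>i. P i x) ` {..m})" "{Q x}"] dim_span_P
    by (simp add: subspace_span)
  have comb_W: "\<exists>r. w = comb r x \<and> ip r q = 0" if w_W: "w \<in> ?W" for w
  proof -
    have "span ((\<lambda>i. P i x) ` {..m}) \<subseteq> range (\<lambda>r. comb r x)"
    proof (rule span_minimal)
      show "(\<lambda>i. P i x) ` {..m} \<subseteq> range (\<lambda>r. comb r x)"
        using comb_delta by (metis (no_types, lifting) atMost_iff image_subset_iff rangeI)
      show "subspace (range (\<lambda>r. comb r x))"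
      proof (rule subspaceI)
        show "0 \<in> range (\<lambda>r. comb r x)"
          by (rule range_eqI[of _ _ "\<lambda>_. 0"]) (simp add: comb_def)
        fix a b assume "a \<in> range (\<lambda>r. comb r x)" "b \<in> range (\<lambda>r. comb r x)"
        then obtain r r' where "a = comb r x" "b = comb r' x" by auto
        then show "a + b \<in> range (\<lambda>r. comb r x)"
          by (intro range_eqI[of _ _ "\<lambda>i. r i + r' i"])
            (simp add: comb_def scaleR_add_left sum.distrib)
      next
        fix k a assume "a \<in> range (\<lambda>r. comb r x)"
        then obtain r where "a = comb r x" by auto
        then show "k *\<^sub>R a \<in> range (\<lambda>r. comb r x)"
          by (intro range_eqI[of _ _ "\<lambda>i. k * r i"]) (simp add: comb_def scaleR_sum_right)
      qed
    qed
    then obtain r where r: "w = comb r x" using w_W by auto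
    then have "ip r q = 0"
      using w_W comb_inner_comb[of r x q] x by simp
    then show ?thesis using r by auto
  qed
  have W_facts: "w \<bullet> x = 0 \<and> W_proj w = w \<and> W_proj (Q w) = - s *\<^sub>R w \<and> Q w \<bullet> w = - s * (w \<bullet> w)"
    if w_W: "w \<in> ?W" for w
  proof -
    obtain r where w: "w = comb r x" and r: "ip r q = 0"
      using comb_W[OF w_W] by auto
    have 1: "w \<bullet> x = 0" by (simp add: w comb_x_inner r)
    have 2: "W_proj w = w"
      unfolding W_proj_def w comb_def[of r x]
      using P_inner_comb[of _ x r] x unfolding comb_def[of r x] by (intro sum.cong refl) simp
    have 3: "W_proj (Q w) = - s *\<^sub>R w"
    proof -
      have "W_proj (Q w) = (\<Sum>i\<le>m. (- s * r i) *\<^sub>R P i x)"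
        by (simp add: W_proj_def w P_inner_Q_comb r)
      then show ?thesis
        by (simp add: w comb_def[of r x] scaleR_sum_right sum_negf)
    qed
    have "w \<bullet> W_proj (Q w) = w \<bullet> Q w"
    proof -
      have "w \<bullet> W_proj (Q w) = W_proj w \<bullet> Q w"
        unfolding inner_commute[of w] W_proj_inner by (simp add: mult.commute)
      then show ?thesis by (simp add: 2)
    qed
    then show ?thesis using 1 2 3 by (simp add: inner_commute)
  qed
  have "inj_on L ?W"
  proof (rule inj_onI)
    fix v w assume v: "v \<in> ?W" and w: "w \<in> ?W" and eq: "L v = L w"
    have d: "v - w \<in> ?W" using subspace_diff[OF W v w] .
    have "L (v - w) = 0" using eq by (simp add: linear_diff[OF L])
    then have "L (v - w) \<bullet> (v - w) = 0" by simp
    then have "ev * ((v - w) \<bullet> (v - w)) = 0"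
      using W_facts[OF d] unfolding L_def inner_add_left ev by (simp add: algebra_simps)
    then show "v = w" using ev_0 by simp
  qed
  then have "inj_on L (span ?W)"
    using W by (simp only: span_eq_iff[THEN iffD2])
  then have "dim (L ` ?W) = dim ?W"
    by (rule dim_image_eq[OF L])
  moreover have "L ` ?W \<subseteq> eigenspace ((c + \<sigma>) / s)"
  proof (rule image_subsetI)
    fix w assume w: "w \<in> ?W"
    then have wQ: "w \<bullet> Q x = 0" by simp
    note wf = W_facts[OF w]
    have "L w \<in> tangent"
      using wf wQ sym_comb[of q w x] sym_comb[of q w "Q x"]
      by (simp add: tangent_def L_def inner_add_left Q_Q)
    moreover have "S_op (L w) = ev *\<^sub>R L w"
    proof -
      have "W_proj (L w) = \<mu> *\<^sub>R W_proj w + W_proj (Q w)"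
        by (simp add: W_proj_def L_def inner_add_right scaleR_add_left sum.distrib scaleR_sum_right)
      then have "W_proj (L w) = (\<mu> - s) *\<^sub>R w"
        using wf by (simp add: scaleR_diff_left)
      then have "S_op (L w) = Q (L w) + (2 / s * (\<mu> - s)) *\<^sub>R w - s *\<^sub>R L w"
        by (simp only: S_op_def scaleR_scaleR)
      also have "2 / s * (\<mu> - s) = \<mu>\<^sup>2 - 1"
        using s \<mu> by (simp add: right_diff_distrib)
      also have "Q (L w) + (\<mu>\<^sup>2 - 1) *\<^sub>R w - s *\<^sub>R L w = (ev * \<mu>) *\<^sub>R w + ev *\<^sub>R Q w"
        by (simp add: ev L_def comb_simps Q_Q power2_eq_square algebra_simps)
      finally show ?thesis by (simp add: L_def scaleR_add_right)
    qed
    ultimately show "L w \<in> eigenspace ((c + \<sigma>) / s)"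
      by (simp add: eigenspace_def ev_def)
  qed
  then have "dim (L ` ?W) \<le> dim (eigenspace ((c + \<sigma>) / s))"
    by (rule dim_subset)
  ultimately show ?thesis
    using \<open>m + 1 \<le> dim ?W + 1\<close> by simp
qed

end

subsection \<open>Principal curvatures and their multiplicities\<close>

lemma subspace_unit_vector:
  fixes S :: "'a::euclidean_space set"
  assumes S: "subspace S" and dim: "0 < dim S"
  obtains v where "v \<in> S" "norm v = 1"
proof -
  have "\<not> S \<subseteq> {0}" using dim by (metis dim_eq_0 less_irrefl)
  then obtain v where v: "v \<in> S" "v \<noteq> 0" by auto
  then show thesis
    using S by (intro that[of "v /\<^sub>R norm v"]) (auto simp: subspace_scale)
qed

section \<open>Eigenspaces of Clifford involutions and nonempty levels\<close>

context clifford
begin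

text \<open>A quarter turn of \<open>(q 0, q 1)\<close> in the plane of the indices 0 and 1, both
  available for \<open>m > 0\<close>; if that pair is zero, the index 0 alone will do.\<close>

lemma exists_orthogonal_coefficients:
  assumes m: "0 < m"
  obtains r where "ip r q = 0" "ip r r \<noteq> 0"
proof (cases "q 0 = 0 \<and> q 1 = 0")
  case True
  then show thesis
    using that[of "\<lambda>k. if k = 0 then 1 else 0"] by (simp add: ip_delta)
next
  case False
  let ?d = "\<lambda>i k. if k = i then 1 else 0 :: real"
  define r :: "nat \<Rightarrow> real" where "r k = q 1 * ?d 0 k - q 0 * ?d 1 k" for k
  have r: "ip r z = q 1 * z 0 - q 0 * z 1" for z
  proof -
    have "ip r z = q 1 * ip (?d 0) z - q 0 * ip (?d 1) z"
      by (simp add: ip_def r_def left_diff_distrib sum_subtractf sum_distrib_left mult.assoc)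
    then show ?thesis using m by (simp only: ip_delta)
  qed
  show thesis
  proof (rule that[of r])
    show "ip r q = 0" by (simp add: r)
    have "r 0 = q 1" "r 1 = - q 0" by (auto simp: r_def)
    then have "ip r r = q 1 * q 1 + q 0 * q 0" by (simp add: r)
    then show "ip r r \<noteq> 0"
      using False by (auto simp: sum_squares_eq_zero_iff)
  qed
qed

lemma subspace_eigenvectors: "subspace {v. comb q v = \<sigma> *\<^sub>R v}"
  by (auto simp: subspace_def comb_simps linear_0[OF linear_comb] scaleR_add_right)

text \<open>A further element of the Clifford sphere orthogonal to \<open>q\<close> exchanges the two eigenspaces.\<close>

lemma dim_eigenvectors:
  assumes m: "0 < m" and q: "ip q q = 1" and \<sigma>: "\<sigma> = 1 \<or> \<sigma> = - 1"
  shows "2 * dim {v. comb q v = \<sigma> *\<^sub>R v} = DIM('a)"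
proof -
  let ?S = "\<lambda>\<sigma>. {v. comb q v = \<sigma> *\<^sub>R v}"
  obtain r where r: "ip r q = 0" "ip r r \<noteq> 0"
    by (rule exists_orthogonal_coefficients[OF m])
  have inj: "inj (comb r)"
    by (rule inj_on_inverseI[of _ "\<lambda>y. comb r y /\<^sub>R ip r r"]) (simp add: comb_comb_self r)
  have le: "dim (?S \<tau>) \<le> dim (?S (- \<tau>))" for \<tau>
  proof -
    have "dim (comb r ` ?S \<tau>) = dim (?S \<tau>)"
      by (rule dim_image_eq[OF linear_comb]) (use inj in \<open>auto intro: inj_on_subset\<close>)
    moreover have "comb r ` ?S \<tau> \<subseteq> ?S (- \<tau>)"
    proof safe
      fix v assume v: "comb q v = \<tau> *\<^sub>R v"
      have "comb q (comb r v) = - comb r (comb q v)"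
        using anti_comb[of q r v] r by (simp add: ip_commute[of q r] eq_neg_iff_add_eq_0)
      then show "comb q (comb r v) = - \<tau> *\<^sub>R comb r v"
        by (simp add: v comb_simps)
    qed
    ultimately show ?thesis by (metis dim_subset)
  qed
  have "dim (?S 1 \<union> ?S (- 1)) = dim (?S 1) + dim (?S (- 1))"
  proof (rule dim_orthogonal_sum)
    fix v w assume "v \<in> ?S 1" "w \<in> ?S (- 1)"
    then show "v \<bullet> w = 0" using sym_comb[of q v w] by simp
  qed
  moreover have "span (?S 1 \<union> ?S (- 1)) = UNIV"
  proof -
    have "y \<in> span (?S 1 \<union> ?S (- 1))" for y
    proof -
      have QQ: "comb q (comb q y) = y" by (simp add: comb_comb_self q)
      have "(1 / 2) *\<^sub>R (y + comb q y) \<in> ?S 1" "(1 / 2) *\<^sub>R (y - comb q y) \<in> ?S (- 1)"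
        by (simp_all add: comb_simps QQ add.commute flip: scaleR_minus_right)
      then have "(1 / 2) *\<^sub>R (y + comb q y) + (1 / 2) *\<^sub>R (y - comb q y) \<in> span (?S 1 \<union> ?S (- 1))"
        by (intro span_add span_base) auto
      then show ?thesis by (simp flip: scaleR_add_right scaleR_2)
    qed
    then show ?thesis by auto
  qed
  then have "dim (?S 1 \<union> ?S (- 1)) = DIM('a)"
    using dim_span[of "?S 1 \<union> ?S (- 1)"] by (simp only: dim_UNIV)
  ultimately show ?thesis
    using le[of 1] le[of "- 1"] \<sigma> by auto
qed

text \<open>Join unit vectors \<open>x\<close> and \<open>v\<close> from the two eigenspaces of
  \<open>P 0\<close> by a great circle, with \<open>v\<close> orthogonal to \<open>P i x\<close> for
  1 \<le> i \<le> m; such a \<open>v\<close> exists since \<open>m < l\<close>. On the circle only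
  the form of \<open>P 0\<close> is nonzero, so \<open>F\<close> runs through all values in
  [-1, 1].\<close>

lemma level_nonempty:
  assumes m: "0 < m" and l: "DIM('a) = 2 * l" "m < l" and c: "- 1 \<le> c" "c \<le> 1"
  shows "level F c \<noteq> {}"
proof -
  let ?d = "\<lambda>k. if k = 0 then 1 else 0 :: real"
  have d: "ip ?d ?d = 1" by (simp add: ip_delta)
  have P0: "comb ?d = P 0" by (simp add: comb_delta)
  have dim: "dim {v. P 0 v = \<sigma> *\<^sub>R v} = l" if "\<sigma> = 1 \<or> \<sigma> = - 1" for \<sigma>
    using dim_eigenvectors[OF m d that] l unfolding P0 by simp
  have sub: "subspace {v. P 0 v = \<sigma> *\<^sub>R v}" for \<sigma>
    using subspace_eigenvectors[of ?d \<sigma>] unfolding P0 .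
  \<comment> \<open>For \<open>i > 0\<close>, \<open>P i\<close> exchanges the eigenspaces of
    \<open>P 0\<close>, which are orthogonal.\<close>
  have null: "P i z \<bullet> z = 0" if z: "P 0 z = \<sigma> *\<^sub>R z" and i: "0 < i" "i \<le> m" and "\<sigma> \<noteq> 0" for \<sigma> i z
  proof -
    have "P i (P 0 z) \<bullet> z = - (P 0 (P i z) \<bullet> z)"
      using anti_P[of i 0 z] i by (simp add: eq_neg_iff_add_eq_0 flip: inner_add_left)
    then show ?thesis
      using sym_P[of 0 "P i z" z] i \<open>\<sigma> \<noteq> 0\<close> by (simp add: z linear_cmul[OF linear_P])
  qed
  obtain x where x: "P 0 x = 1 *\<^sub>R x" "norm x = 1"
    using subspace_unit_vector[OF sub[of 1]] dim[of 1] l by auto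
  let ?V = "{v \<in> {v. P 0 v = (- 1) *\<^sub>R v}. \<forall>y\<in>(\<lambda>i. P i x) ` {1..m}. v \<bullet> y = 0}"
  have "l \<le> dim ?V + card ((\<lambda>i. P i x) ` {1..m})"
    using dim_orthogonal_within_ge[OF sub[of "- 1"], of "(\<lambda>i. P i x) ` {1..m}"] dim[of "- 1"]
    by simp
  moreover have "card ((\<lambda>i. P i x) ` {1..m}) \<le> m"
    using card_image_le[of "{1..m}" "\<lambda>i. P i x"] by simp
  ultimately have V: "0 < dim ?V" using l by linarith
  have V': "subspace ?V"
    using sub[of "- 1"] by (auto simp: subspace_def inner_add_left)
  obtain v where v_V: "v \<in> ?V" and v1: "norm v = 1"
    by (rule subspace_unit_vector[OF V' V])
  then have v: "P 0 v = (- 1) *\<^sub>R v" by blast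
  have v_P: "P i x \<bullet> v = 0" if "0 < i" "i \<le> m" for i
    using v_V that by (auto simp: inner_commute[of v])
  have xv: "x \<bullet> v = 0"
    using sym_P[of 0 x v] by (simp add: x v)
  have xx: "x \<bullet> x = 1" and vv: "v \<bullet> v = 1"
    using x v1 by (simp_all add: norm_eq_1)
  \<comment> \<open>Solves - cos (4 t) = c, as \<open>F y\<close> = 1 - 2 cos (2 t)^2.\<close>
  define t where "t = arccos (- c) / 4"
  define y where "y = cos t *\<^sub>R x + sin t *\<^sub>R v"
  have yy: "y \<bullet> y = 1"
    by (simp add: y_def inner_add_left inner_add_right xx vv xv inner_commute[of v x]
      flip: power2_eq_square)
  have P_y: "P i y \<bullet> y = (if i = 0 then cos (2 * t) else 0)" if i: "i \<le> m" for i
  proof -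
    have "P i y \<bullet> y = cos t * cos t * (P i x \<bullet> x) + 2 * cos t * sin t * (P i x \<bullet> v)
        + sin t * sin t * (P i v \<bullet> v)"
      using i sym_P[OF i, of v x]
      by (simp add: y_def linear_add[OF linear_P] linear_cmul[OF linear_P] inner_add_left
        inner_add_right inner_commute[of v] algebra_simps)
    then show ?thesis
      using null[of x 1 i] null[of v "- 1" i] x v v_P i
      by (auto simp: xx vv xv cos_double power2_eq_square)
  qed
  have "ip (cf y) (cf y) = (\<Sum>i\<le>m. if i = 0 then cos (2 * t) * cos (2 * t) else 0)"
    unfolding ip_def by (intro sum.cong refl) (simp add: P_y)
  then have "F y = 1 - 2 * (cos (2 * t))\<^sup>2"
    by (simp add: F_eq yy power2_eq_square)
  also have "\<dots> = - cos (4 * t)"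
    using cos_double_cos[of "2 * t"] by simp
  also have "\<dots> = c" using c by (simp add: t_def)
  finally show ?thesis
    using yy by (auto simp: level_def norm_eq_1)
qed

lemma clifford_point_exists:
  assumes x: "norm x = 1" and F: "F x = cos A" and A: "0 < A" "A < pi"
  obtains q where "clifford_point m P x q (sin (A / 2)) (cos (A / 2))"
proof
  have s: "0 < sin (A / 2)" and c: "0 < cos (A / 2)"
    using A by (auto intro: sin_gt_zero cos_gt_zero)
  have xx: "x \<bullet> x = 1" using x by (simp add: norm_eq_1)
  have "ip (cf x) (cf x) = (sin (A / 2))\<^sup>2"
    using F cos_double_sin[of "A / 2"] by (simp add: F_eq xx)
  moreover have "ip (\<lambda>i. cf x i / sin (A / 2)) (\<lambda>i. cf x i / sin (A / 2)) =
      ip (cf x) (cf x) / (sin (A / 2))\<^sup>2"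
    by (simp add: ip_def sum_divide_distrib power2_eq_square)
  ultimately have "ip (\<lambda>i. cf x i / sin (A / 2)) (\<lambda>i. cf x i / sin (A / 2)) = 1"
    using s by simp
  then show "clifford_point m P x (\<lambda>i. cf x i / sin (A / 2)) (sin (A / 2)) (cos (A / 2))"
    using s c xx by unfold_locales auto
qed

end

text \<open>By the half-angle formulas these are cot (\<psi>/2 + j pi/4) for j = 0, 1, 2, 3. The
  entries over \<open>s\<close> come from W, those over \<open>c\<close> from the eigenspaces of
  \<open>Q\<close>.\<close>

definition curvatures :: "real \<Rightarrow> real \<Rightarrow> real list" where
  "curvatures s c = [(c + 1) / s, (1 - s) / c, (c - 1) / s, (- 1 - s) / c]"

text \<open>The numbers 1, 0 and - 1 separate the four entries; \<open>1 < s + c\<close> serves for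
  the two inner ones.\<close>

lemma sorted_curvatures:
  assumes s: "0 < s" and c: "0 < c" and sc: "s\<^sup>2 + c\<^sup>2 = 1"
  shows "sorted_wrt (>) (curvatures s c)"
proof -
  have "0 < s\<^sup>2" "0 < c\<^sup>2" using s c by auto
  then have "s\<^sup>2 < 1\<^sup>2" "c\<^sup>2 < 1\<^sup>2"
    using sc unfolding power_one by linarith+
  then have s1: "s < 1" and c1: "c < 1"
    by (auto intro: power2_less_imp_less)
  have "1\<^sup>2 < (s + c)\<^sup>2"
    using sc s c by (simp add: power2_sum)
  then have "1 < s + c"
    using s c by (intro power2_less_imp_less[of 1 "s + c"]) auto
  then have "1 < (c + 1) / s" "(1 - s) / c < 1" "0 < (1 - s) / c" "(c - 1) / s < 0"
    "- 1 < (c - 1) / s" "(- 1 - s) / c < - 1"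
    using s c s1 c1 by (simp_all add: field_simps)
  then show ?thesis
    by (simp add: curvatures_def)
qed

text \<open>The two curvatures over the same denominator have product - 1. Hence the product of
  their factors \<open>cos t - \<kappa> * sin t\<close> involves only double angles: it is sin
  (\<psi> - 2 t) / s for one pair and cos (\<psi> - 2 t) / c for the other.\<close>

lemma focal_curvatures:
  assumes s: "0 < s" and c: "0 < c" and sc: "s\<^sup>2 + c\<^sup>2 = 1"
  shows "(\<exists>\<kappa>\<in>set (curvatures s c). cos t = \<kappa> * sin t) \<longleftrightarrow>
    (s * cos (2 * t) - c * sin (2 * t)) * (c * cos (2 * t) + s * sin (2 * t)) = 0"
proof -
  have "(c + 1) * (c - 1) = - s * s" "(1 - s) * (- 1 - s) = - c * c"
    using sc by (simp_all add: algebra_simps power2_eq_square)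
  then have k: "(c + 1) / s * ((c - 1) / s) = - 1" "(1 - s) / c * ((- 1 - s) / c) = - 1"
    using s c by simp_all
  have e: "(X - a * Y) * (X - b * Y) = X * X - (a + b) * (X * Y) + a * b * (Y * Y)" for X Y a b :: real
    by (simp add: algebra_simps)
  have "s * ((cos t - (c + 1) / s * sin t) * (cos t - (c - 1) / s * sin t)) =
      s * cos (2 * t) - c * sin (2 * t)"
    unfolding e k cos_double sin_double using s by (simp add: field_simps power2_eq_square)
  moreover have "c * ((cos t - (1 - s) / c * sin t) * (cos t - (- 1 - s) / c * sin t)) =
      c * cos (2 * t) + s * sin (2 * t)"
    unfolding e k cos_double sin_double using c by (simp add: field_simps power2_eq_square)
  ultimately have "(s * cos (2 * t) - c * sin (2 * t)) * (c * cos (2 * t) + s * sin (2 * t)) = 0 \<longleftrightarrow>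
      (cos t - (c + 1) / s * sin t) * (cos t - (c - 1) / s * sin t) = 0 \<or>
      (cos t - (1 - s) / c * sin t) * (cos t - (- 1 - s) / c * sin t) = 0"
    using s c by (metis mult_eq_0_iff less_irrefl)
  then show ?thesis
    unfolding mult_eq_0_iff[of "_ - _" "_ - _"] right_minus_eq by (auto simp: curvatures_def)
qed

lemma curvatures_neq:
  assumes s: "0 < s" and c: "0 < c" and sc: "s\<^sup>2 + c\<^sup>2 = 1"
  shows "distinct (curvatures s c)" "(1 - s) / c \<notin> {(c + 1) / s, (c - 1) / s}"
    "(- 1 - s) / c \<notin> {(c + 1) / s, (c - 1) / s}"
proof -
  have "distinct [a, b, d, e]" "b \<notin> {a, d}" "e \<notin> {a, d}" if "sorted_wrt (>) [a, b, d, e]" for a b d e :: real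
    using that by auto
  from this[OF sorted_curvatures[OF assms, unfolded curvatures_def]]
  show "distinct (curvatures s c)" "(1 - s) / c \<notin> {(c + 1) / s, (c - 1) / s}"
    "(- 1 - s) / c \<notin> {(c + 1) / s, (c - 1) / s}"
    unfolding curvatures_def by blast+
qed

section \<open>Exact multiplicities at a point\<close>

context clifford_point
begin

lemma dim_eigenspace:
  assumes m: "0 < m" and l: "DIM('a) = 2 * l" "m < l"
  shows "dim (eigenspace \<kappa>) = (if \<kappa> \<in> set (curvatures s c)
    then (if \<kappa> \<in> {(c + 1) / s, (c - 1) / s} then m else l - m - 1) else 0)"
proof -
  let ?d = "\<lambda>\<kappa>. if \<kappa> \<in> {(c + 1) / s, (c - 1) / s} then m else l - m - 1"
  note neq = curvatures_neq[OF s c sc]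
  have half: "dim {v. Q v = \<sigma> *\<^sub>R v} = l" if "\<sigma> = 1 \<or> \<sigma> = - 1" for \<sigma>
    using dim_eigenvectors[OF m q that] l by simp
  have "dim {v \<in> tangent. S_op v /\<^sub>R c = \<kappa> *\<^sub>R v} = (if \<kappa> \<in> set (curvatures s c) then ?d \<kappa> else 0)"
  proof (rule eigenspace_dims_eqI)
    show "(S_op v /\<^sub>R c) \<bullet> w = v \<bullet> (S_op w /\<^sub>R c)" for v w
      by (simp add: S_op_sym)
    fix \<kappa> assume "\<kappa> \<in> set (curvatures s c)"
    then consider "\<kappa> = (c + 1) / s" | "\<kappa> = (c - 1) / s" | "\<kappa> = (1 - s) / c" | "\<kappa> = (- 1 - s) / c"
      by (auto simp: curvatures_def)
    then show "?d \<kappa> \<le> dim {v \<in> tangent. S_op v /\<^sub>R c = \<kappa> *\<^sub>R v}"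
      unfolding eigenspace_eq[symmetric]
      using neq W_eigenvectors_ge[of 1] W_eigenvectors_ge[of "- 1"]
        Q_eigenvectors_ge[of 1] Q_eigenvectors_ge[of "- 1"] half[of 1] half[of "- 1"]
      by cases (auto simp: curvatures_def simp del: dim_eq_0)
  next
    have "sum ?d (set (curvatures s c)) = 2 * m + 2 * (l - m - 1)"
      unfolding sum.distinct_set_conv_list[OF neq(1)] using neq(2,3)
      by (simp add: curvatures_def)
    then show "dim tangent \<le> sum ?d (set (curvatures s c))"
      using dim_tangent l by simp
  qed simp
  then show ?thesis by (simp only: eigenspace_eq)
qed

lemma curvature_multiplicity_eq:
  assumes "0 < m" "DIM('a) = 2 * l" "m < l"
  shows "curvature_multiplicity F x \<kappa> = (if \<kappa> \<in> set (curvatures s c)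
    then (if \<kappa> \<in> {(c + 1) / s, (c - 1) / s} then m else l - m - 1) else 0)"
  using dim_eigenspace[OF assms] by (simp only: curvature_multiplicity_x)

text \<open>Here \<open>m + 1 < l\<close> makes \<open>l - m - 1\<close> positive, so that all four
  candidates really occur.\<close>

lemma principal_curvatures_eq:
  assumes "0 < m" "DIM('a) = 2 * l" "m + 1 < l"
  shows "principal_curvatures F x = set (curvatures s c)"
  using assms unfolding principal_curvatures_x
  by (auto simp: dim_eigenspace[of l] simp del: dim_eq_0 split: if_splits)

lemma map_multiplicities:
  assumes "0 < m" "DIM('a) = 2 * l" "m < l"
  shows "map (curvature_multiplicity F x) (curvatures s c) = [m, l - m - 1, m, l - m - 1]"
  using curvatures_neq(2,3)[OF s c sc]
  by (simp add: curvatures_def curvature_multiplicity_eq[OF assms])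

lemma regular_point:
  "F differentiable (at x within sphere 0 1) \<and> sphere_grad F x \<noteq> 0 \<and>
    unit_normal F differentiable (at x within sphere 0 1)"
proof (intro conjI unit_normal_differentiable)
  show "F differentiable (at x within sphere 0 1)"
    unfolding differentiable_def by (rule exI) (rule F_has_derivative)
  have "nu \<noteq> 0" using nu_nu by auto
  then show "sphere_grad F x \<noteq> 0"
    using s c by (simp add: sphere_grad_x)
qed

end

context clifford
begin

subsection \<open>Parallel hypersurfaces\<close>

text \<open>The results on \<open>geo\<close> in terms of A = 2 \<psi>: the shift by 2 t becomes one
  by 4 t, and sin (A - 4 t) has the sign of \<open>sg t * cg t\<close>.\<close>

lemma parallel_point:
  assumes x: "norm x = 1" and F: "F x = cos A" and A: "0 < A" "A < pi"
    and y: "y = cos t *\<^sub>R x + sin t *\<^sub>R unit_normal F x"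
  shows "norm y = 1" "F y = cos (A - 4 * t)"
    "sin (A - 4 * t) \<noteq> 0 \<Longrightarrow>
      unit_normal F y = sgn (sin (A - 4 * t)) *\<^sub>R (cos t *\<^sub>R unit_normal F x - sin t *\<^sub>R x)"
proof -
  obtain q where "clifford_point m P x q (sin (A / 2)) (cos (A / 2))"
    by (rule clifford_point_exists[OF x F A])
  then interpret clifford_point m P x q "sin (A / 2)" "cos (A / 2)" .
  have y_geo: "y = geo t"
    by (simp add: y geo_def unit_normal_x)
  have sg: "sg t = sin (A / 2 - 2 * t)" and cg: "cg t = cos (A / 2 - 2 * t)"
    by (simp_all add: sg_def cg_def sin_diff cos_diff)
  have sin_A: "sin (A - 4 * t) = 2 * (sg t * cg t)"
    using sin_double[of "A / 2 - 2 * t"] by (simp add: sg cg right_diff_distrib)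
  show "norm y = 1"
    using geo_unit by (simp add: y_geo norm_eq_1)
  show "F y = cos (A - 4 * t)"
    using cos_double_sin[of "A / 2 - 2 * t"] by (simp add: y_geo F_geo sg right_diff_distrib)
  assume "sin (A - 4 * t) \<noteq> 0"
  then have "sg t * cg t \<noteq> 0" by (simp add: sin_A)
  then show "unit_normal F y = sgn (sin (A - 4 * t)) *\<^sub>R (cos t *\<^sub>R unit_normal F x - sin t *\<^sub>R x)"
    using normal_geo[of t] by (simp add: y_geo sin_A sgn_mult geo'_def unit_normal_x)
qed

text \<open>The normal of the level through \<open>y\<close> points backwards along the geodesic from \<open>x\<close> when an odd
  number of focal points lies in between; hence the sign \<open>\<sigma>\<close> when going back from \<open>y\<close> to \<open>x\<close>.\<close>

lemma parallel_level_eq: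
  assumes A: "0 < A" "A < pi" and t: "sin (A - 4 * t) \<noteq> 0"
  shows "parallel_level F (cos A) t = level F (cos (A - 4 * t))"
proof
  show "parallel_level F (cos A) t \<subseteq> level F (cos (A - 4 * t))"
    using parallel_point(1,2)[OF _ _ A refl] by (auto simp: parallel_level_def level_def)
  show "level F (cos (A - 4 * t)) \<subseteq> parallel_level F (cos A) t"
  proof
    fix y assume "y \<in> level F (cos (A - 4 * t))"
    then have y: "norm y = 1" "F y = cos (A - 4 * t)" by (auto simp: level_def)
    define \<sigma> where "\<sigma> = sgn (sin (A - 4 * t))"
    have \<sigma>: "\<sigma> = 1 \<or> \<sigma> = - 1" using t by (simp add: \<sigma>_def sgn_if)
    then have \<sigma>2: "\<sigma> * \<sigma> = 1" by auto
    have sin_\<sigma>: "sin (\<sigma> * a) = \<sigma> * sin a" and cos_\<sigma>: "cos (\<sigma> * a) = cos a" for a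
      using \<sigma> by auto
    \<comment> \<open>The angle in (0, pi) that belongs to the level of \<open>y\<close>; it equals
      \<sigma> (A - 4 t) modulo 2 pi.\<close>
    define B where "B = arccos (cos (A - 4 * t))"
    have cos_B: "cos B = cos (A - 4 * t)"
      by (simp add: B_def)
    have sin_B: "sin B = \<sigma> * sin (A - 4 * t)"
    proof -
      have "sin B = sqrt (1 - (cos (A - 4 * t))\<^sup>2)"
        unfolding B_def by (rule sin_arccos_abs) simp
      also have "\<dots> = \<bar>sin (A - 4 * t)\<bar>"
        by (simp flip: sin_squared_eq)
      finally show ?thesis by (simp add: \<sigma>_def abs_sgn mult.commute)
    qed
    have "0 \<le> B" "B \<le> pi"
      by (simp_all add: B_def arccos_lbound arccos_ubound)
    moreover have "sin B \<noteq> 0" using t \<sigma> by (auto simp: sin_B)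
    then have "B \<noteq> 0" "B \<noteq> pi" by auto
    ultimately have B: "0 < B" "B < pi" by auto
    \<comment> \<open>The normal at \<open>y\<close> should be \<sigma> times the velocity of the
      incoming geodesic, so the way back has displacement - \<sigma> t. Applying
      \<open>parallel_point\<close> at \<open>y\<close> confirms that \<open>x\<close> has level cos
      A and normal in the right direction.\<close>
    define x where "x = cos (- \<sigma> * t) *\<^sub>R y + sin (- \<sigma> * t) *\<^sub>R unit_normal F y"
    have F_y: "F y = cos B" using y cos_B by simp
    note ret = parallel_point[OF y(1) F_y B x_def]
    have A_split: "A = (A - 4 * t) + 4 * t" by simp
    have four: "B - 4 * (- \<sigma> * t) = B + \<sigma> * (4 * t)" by simp
    have "cos (B - 4 * (- \<sigma> * t)) = cos (A - 4 * t) * cos (4 * t) - (\<sigma> * \<sigma>) * (sin (A - 4 * t) * sin (4 * t))"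
      unfolding four cos_add sin_\<sigma> cos_\<sigma> cos_B sin_B by simp
    also have "\<dots> = cos A"
      unfolding \<sigma>2 by (subst A_split) (simp only: cos_add mult_1)
    finally have cos_A: "cos (B - 4 * (- \<sigma> * t)) = cos A" .
    have "sin (B - 4 * (- \<sigma> * t)) = \<sigma> * (sin (A - 4 * t) * cos (4 * t) + cos (A - 4 * t) * sin (4 * t))"
      unfolding four sin_add sin_\<sigma> cos_\<sigma> cos_B sin_B by (simp add: algebra_simps)
    also have "\<dots> = \<sigma> * sin A"
      using sin_add[of "A - 4 * t" "4 * t"] by simp
    finally have sin_A: "sin (B - 4 * (- \<sigma> * t)) = \<sigma> * sin A" .
    have pos: "0 < sin A" using A by (rule sin_gt_zero)
    have "sgn (sin (B - 4 * (- \<sigma> * t))) = \<sigma>"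
      unfolding sin_A using pos \<sigma> by (auto simp: sgn_mult)
    moreover have "sin (B - 4 * (- \<sigma> * t)) \<noteq> 0"
      unfolding sin_A using pos \<sigma> by auto
    ultimately have n: "unit_normal F x =
        \<sigma> *\<^sub>R (cos (- \<sigma> * t) *\<^sub>R unit_normal F y - sin (- \<sigma> * t) *\<^sub>R y)"
      using ret(3) by simp
    have n_x: "unit_normal F x = (\<sigma> * cos t) *\<^sub>R unit_normal F y + (\<sigma> * \<sigma> * sin t) *\<^sub>R y"
      unfolding n using sin_\<sigma>[of t] cos_\<sigma>[of t] by (simp add: scaleR_diff_right scaleR_add_right)
    have x_eq: "x = cos t *\<^sub>R y - (\<sigma> * sin t) *\<^sub>R unit_normal F y"
      unfolding x_def using sin_\<sigma>[of t] cos_\<sigma>[of t] by simp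
    have "cos t *\<^sub>R x + sin t *\<^sub>R unit_normal F x =
        (cos t * cos t) *\<^sub>R y + (sin t * sin t) *\<^sub>R y"
      by (subst n_x[unfolded \<sigma>2], subst x_eq) (simp add: algebra_simps)
    then have "y = cos t *\<^sub>R x + sin t *\<^sub>R unit_normal F x"
      by (simp flip: scaleR_add_left)
    moreover have "x \<in> level F (cos A)"
      using ret(1,2) cos_A by (simp add: level_def)
    ultimately show "y \<in> parallel_level F (cos A) t"
      unfolding parallel_level_def by blast
  qed
qed

text \<open>All points of a level have the same curvatures, so the quantifier over points reduces to
  nonemptiness of the level. Focal displacements are those that reach F = 1 or F = - 1.\<close>

lemma focal_distance_iff:
  assumes m: "0 < m" and l: "DIM('a) = 2 * l" "m + 1 < l" and A: "0 < A" "A < pi"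
  shows "focal_distance F (cos A) t \<longleftrightarrow> sin (A - 4 * t) = 0"
proof -
  have curv: "principal_curvatures F x = set (curvatures (sin (A / 2)) (cos (A / 2)))"
    if "x \<in> level F (cos A)" for x
  proof -
    have "norm x = 1" "F x = cos A" using that by (auto simp: level_def)
    then obtain q where "clifford_point m P x q (sin (A / 2)) (cos (A / 2))"
      using A by (rule clifford_point_exists)
    then show ?thesis
      using m l by (rule clifford_point.principal_curvatures_eq)
  qed
  have s: "0 < sin (A / 2)" and c: "0 < cos (A / 2)"
    using A by (auto intro: sin_gt_zero cos_gt_zero)
  have "level F (cos A) \<noteq> {}"
    using m l by (intro level_nonempty[of l]) auto
  then have "focal_distance F (cos A) t \<longleftrightarrow>
      (\<exists>\<kappa>\<in>set (curvatures (sin (A / 2)) (cos (A / 2))). cos t = \<kappa> * sin t)"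
    unfolding focal_distance_def using curv by auto
  also have "\<dots> \<longleftrightarrow> sin (A / 2 - 2 * t) * cos (A / 2 - 2 * t) = 0"
    unfolding focal_curvatures[OF s c sin_cos_squared_add] by (simp add: sin_diff cos_diff)
  also have "\<dots> \<longleftrightarrow> sin (A - 4 * t) = 0"
    using sin_double[of "A / 2 - 2 * t"] by (simp add: right_diff_distrib)
  finally show ?thesis .
qed

text \<open>The order of quantifiers is the point: \<open>s\<close> and \<open>c\<close> belong to
  the level, and only \<open>q\<close> varies with \<open>x\<close>. This makes the curvatures
  constant.\<close>

lemma level_points:
  assumes k: "k \<in> {- 1<..<1}"
  obtains s c where "0 < s" "0 < c" "s\<^sup>2 + c\<^sup>2 = 1"
    and "\<And>x. x \<in> level F k \<Longrightarrow> \<exists>q. clifford_point m P x q s c"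
proof -
  define A where "A = arccos k"
  have A: "0 < A" "A < pi"
    using k arccos_lt_bounded[of k] by (auto simp: A_def)
  have cos_A: "cos A = k" using k by (simp add: A_def)
  show thesis
  proof (rule that)
    show "0 < sin (A / 2)" "0 < cos (A / 2)"
      using A by (auto intro: sin_gt_zero cos_gt_zero)
    show "(sin (A / 2))\<^sup>2 + (cos (A / 2))\<^sup>2 = 1" by (rule sin_cos_squared_add)
    fix x assume "x \<in> level F k"
    then have x: "norm x = 1" "F x = cos A" by (auto simp: level_def cos_A)
    obtain q where "clifford_point m P x q (sin (A / 2)) (cos (A / 2))"
      by (rule clifford_point_exists[OF x A])
    then show "\<exists>q. clifford_point m P x q (sin (A / 2)) (cos (A / 2))" by (intro exI)
  qed
qed

section \<open>The isoparametric family when \<open>m2\<close> is positive\<close>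

context
  fixes l
  assumes m: "0 < m" and l: "DIM('a) = 2 * l" "m + 1 < l"
begin

lemma level_curvatures:
  assumes k: "k \<in> {- 1<..<1}"
  obtains \<kappa>s where "sorted_wrt (>) \<kappa>s" "length \<kappa>s = 4"
    and "\<And>x. x \<in> level F k \<Longrightarrow> principal_curvatures F x = set \<kappa>s"
    and "\<And>x. x \<in> level F k \<Longrightarrow>
      map (curvature_multiplicity F x) \<kappa>s = [m, l - m - 1, m, l - m - 1]"
proof -
  obtain s c where s: "0 < s" and c: "0 < c" and sc: "s\<^sup>2 + c\<^sup>2 = 1"
    and pt: "\<And>x. x \<in> level F k \<Longrightarrow> \<exists>q. clifford_point m P x q s c"
    by (rule level_points[OF k]) (rule that)
  show thesis
  proof (rule that)
    show "sorted_wrt (>) (curvatures s c)" by (rule sorted_curvatures[OF s c sc])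
    show "length (curvatures s c) = 4" by (simp add: curvatures_def)
    fix x assume "x \<in> level F k"
    then obtain q where q: "clifford_point m P x q s c" using pt by blast
    show "principal_curvatures F x = set (curvatures s c)"
      by (rule clifford_point.principal_curvatures_eq[OF q m l])
    have "m < l" using l by simp
    then show "map (curvature_multiplicity F x) (curvatures s c) = [m, l - m - 1, m, l - m - 1]"
      by (rule clifford_point.map_multiplicities[OF q m l(1)])
  qed
qed

lemma isoparametric_level_F:
  assumes k: "k \<in> {- 1<..<1}"
  shows "isoparametric_level F k"
proof -
  obtain s c where s: "0 < s" and c: "0 < c" and sc: "s\<^sup>2 + c\<^sup>2 = 1"
    and pt: "\<And>x. x \<in> level F k \<Longrightarrow> \<exists>q. clifford_point m P x q s c"
    by (rule level_points[OF k]) (rule that)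
  have ml: "m < l" using l by simp
  have "level F k \<noteq> {}"
    using k by (intro level_nonempty[OF m l(1) ml]) auto
  then have "regular_level F k"
    unfolding regular_level_def using pt clifford_point.regular_point by blast
  moreover have "principal_curvatures F x = principal_curvatures F y \<and>
      (\<forall>\<kappa>. curvature_multiplicity F x \<kappa> = curvature_multiplicity F y \<kappa>)"
    if "x \<in> level F k" "y \<in> level F k" for x y
  proof -
    obtain q where q: "clifford_point m P x q s c" using pt \<open>x \<in> level F k\<close> by blast
    obtain q' where q': "clifford_point m P y q' s c" using pt \<open>y \<in> level F k\<close> by blast
    show ?thesis
      by (simp only: clifford_point.principal_curvatures_eq[OF q m l]
        clifford_point.principal_curvatures_eq[OF q' m l]
        clifford_point.curvature_multiplicity_eq[OF q m l(1) ml]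
        clifford_point.curvature_multiplicity_eq[OF q' m l(1) ml] simp_thms)
  qed
  ultimately show ?thesis
    unfolding isoparametric_level_def by blast
qed

lemma isoparametric_family_F: "isoparametric_family F"
  unfolding isoparametric_family_def
proof (intro conjI ballI isoparametric_level_F)
  fix k :: real assume k: "k \<in> {- 1<..<1}"
  define A where "A = arccos k"
  have A: "0 < A" "A < pi"
    using k arccos_lt_bounded[of k] by (auto simp: A_def)
  have cos_A: "cos A = k" using k by (simp add: A_def)
  note focal = focal_distance_iff[OF m l A, unfolded cos_A]
  note parallel = parallel_level_eq[OF A, unfolded cos_A]
  show "level F ` {- 1<..<1} = parallel_level F k ` {t. \<not> focal_distance F k t}"
  proof
    show "level F ` {- 1<..<1} \<subseteq> parallel_level F k ` {t. \<not> focal_distance F k t}"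
    proof (rule image_subsetI)
      fix k' :: real assume k': "k' \<in> {- 1<..<1}"
      \<comment> \<open>The displacement that moves the angle \<open>A\<close> of the level
        \<open>k\<close> to the angle of \<open>k'\<close>.\<close>
      define t where "t = (A - arccos k') / 4"
      have t: "A - 4 * t = arccos k'" unfolding t_def by (simp add: field_simps)
      have "0 < sin (arccos k')"
        using k' arccos_lt_bounded[of k'] by (intro sin_gt_zero) auto
      then have "sin (A - 4 * t) \<noteq> 0" by (simp add: t)
      then have "\<not> focal_distance F k t" "level F k' = parallel_level F k t"
        using k' focal parallel by (simp_all add: t)
      then show "level F k' \<in> parallel_level F k ` {t. \<not> focal_distance F k t}" by blast
    qed
    show "parallel_level F k ` {t. \<not> focal_distance F k t} \<subseteq> level F ` {- 1<..<1}"
    proof (rule image_subsetI)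
      fix t assume "t \<in> {t. \<not> focal_distance F k t}"
      then have sin: "sin (A - 4 * t) \<noteq> 0" by (simp add: focal)
      then have "0 < (sin (A - 4 * t))\<^sup>2" by simp
      then have "(cos (A - 4 * t))\<^sup>2 < 1"
        using sin_cos_squared_add[of "A - 4 * t"] by linarith
      then have "cos (A - 4 * t) \<in> {- 1<..<1}"
        by (simp add: abs_square_less_1 abs_less_iff)
      then show "parallel_level F k t \<in> level F ` {- 1<..<1}"
        using parallel[OF sin] by blast
    qed
  qed
qed

end

end

theorem theorem4p1:
  fixes l m m1 :: nat and m2 :: int
    and P :: "nat \<Rightarrow> real ^ 'n \<Rightarrow> real ^ 'n" and F :: "real ^ 'n \<Rightarrow> real"
  assumes "l > 0" and "m > 0" and "CARD('n) = 2 * l"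
    and "clifford_system m P"
    and "m1 = m" and "m2 = int l - int m - 1"
    and "F = clifford_polynomial m P"
  shows "(\<forall>x. (norm (grad F x))\<^sup>2 = 16 * norm x ^ 6 \<and>
              laplacian F x = 8 * real_of_int (m2 - int m1) * (norm x)\<^sup>2) \<and>
         (m2 > 0 \<longrightarrow> isoparametric_family F \<and>
           (\<forall>c\<in>{-1<..<1}. (\<forall>x\<in>level F c. card (principal_curvatures F x) = 4) \<and>
              has_multiplicities F c [m1, nat m2, m1, nat m2]))"
proof -
  let ?F = "clifford_polynomial m P"
  interpret clifford m P by unfold_locales (rule assms)
  have dim: "DIM(real ^ 'n) = 2 * l" using assms(3) by simp
  \<comment> \<open>With dimension 2 l the coefficient 8 l - 16 m - 8 is 8 (m2 - m1). Computing
    \<open>m2\<close> in the integers keeps this valid when l - m - 1 is negative.\<close>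
  have lap: "laplacian ?F x = 8 * real_of_int (m2 - int m1) * (norm x)\<^sup>2" for x
    unfolding assms(5,6) laplacian_F[OF assms(2)] dim power2_norm_eq_inner
    by (simp add: algebra_simps)
  have "isoparametric_family ?F \<and>
      (\<forall>c\<in>{-1<..<1}. (\<forall>x\<in>level ?F c. card (principal_curvatures ?F x) = 4) \<and>
        has_multiplicities ?F c [m1, nat m2, m1, nat m2])" if "m2 > 0"
  proof (intro conjI ballI)
    have ml: "m + 1 < l" and m2: "nat m2 = l - m - 1"
      using that assms(6) by auto
    show "isoparametric_family ?F"
      by (rule isoparametric_family_F[OF assms(2) dim ml])
    fix c :: real assume c: "c \<in> {-1<..<1}"
    obtain \<kappa>s where \<kappa>s: "sorted_wrt (>) \<kappa>s" "length \<kappa>s = 4"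
      and curv: "\<And>x. x \<in> level ?F c \<Longrightarrow> principal_curvatures ?F x = set \<kappa>s"
      and mult: "\<And>x. x \<in> level ?F c \<Longrightarrow>
        map (curvature_multiplicity ?F x) \<kappa>s = [m, l - m - 1, m, l - m - 1]"
      by (rule level_curvatures[OF assms(2) dim ml c]) (rule that)
    show "has_multiplicities ?F c [m1, nat m2, m1, nat m2]"
      unfolding has_multiplicities_def m2 assms(5) using \<kappa>s(1) curv mult by blast
    have "distinct \<kappa>s"
      using \<kappa>s(1) by (induction \<kappa>s) auto
    then show "card (principal_curvatures ?F x) = 4" if "x \<in> level ?F c" for x
      using curv[OF that] \<kappa>s(2) by (simp add: distinct_card)
  qed
  then show ?thesis
    unfolding assms(7) using norm_grad_F lap by blast
qed

end
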